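(* Let $v=0012^{n_0}12^{n_1}\cdots 12^{n_r}C$ be a Dyck vector where $r\ge 0$, $n_i\ge 0$ for all $i$, $n_r>0$, and $C$ is a binary vector (a possibly empty word in $\{0,1\}$). For $0\le i\le r+1$, let $p_i$ be the number of even integers in the list $n_0,\ldots,n_{i-1}$. Let $S_0(v),\ldots,S_J(v)$ and $L_j=\mathrm{len}(S_j(v))$ be as in the context. (a) The NU-chain starting at $[v]$ contains all Dyck classes $[v^{(0)}]=[v],[v^{(1)}],\ldots,[v^{(r+1)}]$, where for $0\le i\le r$ $$v^{(i)}=0012^{n_i}\cdots 12^{n_r}1^{p_i}C\,1^{2\lfloor n_0/2\rfloor}01^{n_0\bmod 2}\cdots 1^{2\lfloor n_{i-1}/2\rfloor}01^{n_{i-1}\bmod 2},$$ and $$v^{(r+1)}=001^{p_{r+1}}C\,1^{2\lfloor n_0/2\rfloor}01^{n_0\bmod 2}\cdots 1^{2\lfloor n_{r-1}/2\rfloor}01^{n_{r-1}\bmod 2}\,1^{2\lfloor n_r/2\rfloor}(01)^{n_r\bmod 2}.$$ We have $[v^{(r+1)}]=\mathrm{TI}(\mu)$ for some partition $\mu$. (b) Put $L=\mathrm{len}(v^{(i)})=\mathrm{min}_{\Delta}(v^{(i)})$. For $i\le r$, the $\mathrm{min}_{\Delta}$-profile of the part of the NU-chain from $[v^{(i)}]$ through $[v^{(i+1)}]$ always starts $L,(L+1,L)^{\lceil n_i/2\rceil}$; this is followed by $(L+1)^L$ if $n_i$ is even and $i<r$. For $i=r+1$, the $\mathrm{min}_{\Delta}$-profile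 of the NU-chain from $\mathrm{TI}(\mu)$ onward is $L(L+1)^L(L+2)^{L+1}\cdots$. (c) For all $i>0$, $\mathrm{NU}^i([v])$ is a $\mathrm{NU}_1$-initial object if and only if $\mathrm{min}_{\Delta}(\mathrm{NU}^{i-1}([v]))>\mathrm{min}_{\Delta}(\mathrm{NU}^i([v]))$. (d) The reduced vectors $S_j(v)$ representing the $\mathrm{NU}_1$-initial objects in the NU-chain starting at $[v]$ are: $v$ itself, if $C$ is empty or ends in $1$; $v^{(i)}$, for each $i>0$ such that $n_{i-1}$ is odd; and all vectors $$0012^{n_i-2c}12^{n_{i+1}}\cdots 12^{n_r}1^{p_i}C\,1^{2\lfloor n_0/2\rfloor}01^{n_0\bmod 2}\cdots 1^{2\lfloor n_{i-1}/2\rfloor}01^{n_{i-1}\bmod 2}1^{2c}$$ where $0\le i\le r$ and $0<2c\le n_i$. The final vector $v^{(r+1)}$ is $S_J(v)$. (e) Each $S_j(v)$ except $S_J(v)$ contains a $2$. For $j>0$, each $S_j(v)$ is a reduced Dyck vector of the form $00X1$ with $X$ ternary (a word in $\{0,1,2\}$). No other reduced representatives of classes in the chain from $\mathrm{NU}([v])$ to $[S_J(v)]$ have this form. For any Dyck class $\delta$ in the NU-chain starting at $[v]$, $\mathrm{min}_{\Delta}(\delta)<\mathrm{min}_{\Delta}(\mathrm{NU}(\delta))$ if and only if the reduced Dyck vector for $\delta$ begins with $00$. (f) The $\mathrm{min}_{\Delta}$-profile from $[S_j(v)]$ to just before $[S_{j+1}(v)]$ is a prefix of $L_j(L_j+1)^{L_j}(L_j+2)^{L_j+1}\cdots$.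 Each $[S_j(v)]$ is immediately preceded (if $j>0$) and followed by an object with $\mathrm{min}_{\Delta}$ equal to $L_j+1$. Hence $L_0\le L_1\le\cdots\le L_J$. (g) For $0\le j<J$, $\mathrm{area}(S_{j+1}(v))=\mathrm{area}(S_j(v))-2$.
   Context: A quasi-Dyck vector (QDV) is an integer sequence $v=v_1v_2\cdots v_n$ with $v_1=0$ and $v_{i+1}\le v_i+1$ for all $i<n$; a Dyck vector is a QDV with all entries $\ge 0$. $\mathrm{len}(v)=n$, $\mathrm{area}(v)=v_1+\cdots+v_n$. We use word notation; $i^c$ means $c$ copies of the symbol $i$, and $(W)^m$ means $m$ concatenated copies of the list $W$ (empty if $m=0$); $W^{+}$ adds $1$ to each entry of $W$. So $1^{2\lfloor n/2\rfloor}01^{n\bmod 2}$ is $1^n0$ for $n$ even and $1^{n-1}01$ for $n$ odd. Dyck classes $[v]$ are the equivalence classes of the equivalence relation on QDVs generated by $v\sim 0v^+$. An integer partition $\lambda$ (with $\ell(\lambda)$ positive parts and $\lambda_i=0$ for $i>\ell(\lambda)$; the zero partition $\langle 0\rangle=[0]$ is allowed) is identified with the Dyck class consisting of all QDVs $\mathrm{QDV}_n(\lambda)=(0-\lambda_n,1-\lambda_{n-1},\ldots,n-1-\lambda_1)$, $n>\ell(\lambda)$; this is a bijection between partitions and Dyck classes. $\mathrm{min}_{\Delta}(\lambda)$ is the least $n>\ell(\lambda)$ such that $\mathrm{QDV}_n(\lambda)$ has all entries nonnegative; that vector is the reduced Dyck vector of $\lambda$ (of its class); $\mathrm{min}_{\Delta}(v)=\mathrm{min}_{\Delta}([v])$.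 The $\mathrm{min}_{\Delta}$-profile of a sequence of partitions is the sequence of their $\mathrm{min}_{\Delta}$ values. The maps. $\mathrm{NU}_1$ is defined on $D_1=\{\gamma:\gamma_1\le\ell(\gamma)+2\}$ by $\mathrm{NU}_1(\gamma)=\langle\ell+1,\gamma_1-1,\ldots,\gamma_\ell-1\rangle$, $\ell=\ell(\gamma)$ (zero parts dropped); a partition is $\mathrm{NU}_1$-initial if it is not in the image of $\mathrm{NU}_1$ (i.e. it is $\langle 0\rangle$ or has $\gamma_1<\ell(\gamma)$). $\mathrm{NU}_2$ is defined by two rules. Rule (a): $\mathrm{NU}_2([012^hA(-1)^{h-1}])=[00^{h-1}1A1^h]$ for $h\ge 2$ and $A=A_1\cdots A_s$ a list of integers that is empty or satisfies all $A_i\le 2$, $A_s\ge 0$, $A_{i+1}\le A_i+1$ for $i<s$. Rule (b): $\mathrm{NU}_2([012^kB(-1)^k])=[00^kB01^k]$ for $k\ge 1$ and $B=B_1\cdots B_s$ a list of integers that is empty or satisfies all $B_i\le 2$, $B_1\le 1$, $B_s\ge -1$, $B_{i+1}\le B_i+1$ for $i<s$. The domain of $\mathrm{NU}_2$ is disjoint from $D_1$, and $\mathrm{NU}$ is the combined (injective) map. The NU-chain starting at $[v]$ is $(\mathrm{NU}^i([v]):i\ge 0)$. For nonzero $\mu=\langle r^{n_r}\cdots 2^{n_2}1^{n_1}\rangle$ with $n_r>0$, $B_\mu=01^{n_1}01^{n_2}\cdots 01^{n_r}$; $B_{\langle 0\rangle}$ is empty; $\mathrm{TI}(\mu)=[0B_\mu]$.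 For $v=00A^+B$ a Dyck vector with $A,B$ binary words and $A^+$ ending in $2$ (as is the case here): $S_0(v)=v$, and $S_1(v),\ldots,S_J(v)$ are the reduced Dyck vectors of all the $\mathrm{NU}_1$-initial objects in the chain $(\mathrm{NU}^i([v]):i>0)$, listed in the order they appear ($J$ is finite). $L_j=\mathrm{len}(S_j(v))=\mathrm{min}_{\Delta}([S_j(v)])$. *)

theory Defs
  imports Main "HOL-Library.Sublist"
begin

section \<open>Quasi-Dyck vectors, Dyck classes and partitions\<close>

definition qdv :: "int list \<Rightarrow> bool" where
  "qdv v \<longleftrightarrow> v \<noteq> [] \<and> hd v = 0 \<and> successively (\<lambda>a b. b \<le> a + 1) v"

definition dyck :: "int list \<Rightarrow> bool" where
  "dyck v \<longleftrightarrow> qdv v \<and> (\<forall>x\<in>set v. x \<ge> 0)"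

abbreviation area :: "int list \<Rightarrow> int" where
  "area v \<equiv> sum_list v"

definition dyck_step :: "int list \<Rightarrow> int list \<Rightarrow> bool" where
  "dyck_step v w \<longleftrightarrow> qdv v \<and> w = 0 # map (\<lambda>x. x + 1) v"

definition dclass :: "int list \<Rightarrow> int list set" where
  "dclass v = {w. equivclp dyck_step v w}"

definition is_ptn :: "nat list \<Rightarrow> bool" where
  "is_ptn p \<longleftrightarrow> sorted_wrt (\<ge>) p \<and> 0 \<notin> set p"

text \<open>Parts are numbered from 1, and \<open>part p i = 0\<close> beyond the last positive part.\<close>

definition part :: "nat list \<Rightarrow> nat \<Rightarrow> nat" where
  "part p i = (if 1 \<le> i \<and> i \<le> length p then p ! (i - 1) else 0)"

definition qdv_of :: "nat \<Rightarrow> nat list \<Rightarrow> int list" where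
  "qdv_of n p = map (\<lambda>i. int i - int (part p (n - i))) [0..<n]"

definition ptn_class :: "nat list \<Rightarrow> int list set" where
  "ptn_class p = {qdv_of n p | n. n > length p}"

text \<open>Partitions correspond bijectively to Dyck classes via \<open>ptn_class\<close>; \<open>ptn_of\<close> is the inverse.\<close>

definition ptn_of :: "int list set \<Rightarrow> nat list" where
  "ptn_of \<delta> = (THE p. is_ptn p \<and> ptn_class p = \<delta>)"

definition min_delta :: "int list set \<Rightarrow> nat" where
  "min_delta \<delta> =
     (LEAST n. n > length (ptn_of \<delta>) \<and> (\<forall>x\<in>set (qdv_of n (ptn_of \<delta>)). x \<ge> 0))"

definition reduced :: "int list set \<Rightarrow> int list" where
  "reduced \<delta> = qdv_of (min_delta \<delta>) (ptn_of \<delta>)"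

section \<open>The map NU\<close>

definition D1 :: "nat list set" where
  "D1 = {p. is_ptn p \<and> part p 1 \<le> length p + 2}"

definition NU1 :: "nat list \<Rightarrow> nat list" where
  "NU1 p = (length p + 1) # filter (\<lambda>x. x > 0) (map (\<lambda>x. x - 1) p)"

definition NU1_initial :: "int list set \<Rightarrow> bool" where
  "NU1_initial \<delta> \<longleftrightarrow> \<delta> \<notin> (\<lambda>p. ptn_class (NU1 p)) ` D1"

inductive NU2_rel :: "int list set \<Rightarrow> int list set \<Rightarrow> bool" where
  rule_a:
    "\<lbrakk>h \<ge> 2; \<forall>x\<in>set A. x \<le> 2; A = [] \<or> last A \<ge> 0;
      successively (\<lambda>a b. b \<le> a + 1) A\<rbrakk> \<Longrightarrow>
     NU2_rel (dclass ([0,1] @ replicate h 2 @ A @ replicate (h - 1) (-1)))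
             (dclass ([0] @ replicate (h - 1) 0 @ [1] @ A @ replicate h 1))"
| rule_b:
    "\<lbrakk>k \<ge> 1; \<forall>x\<in>set B. x \<le> 2; B = [] \<or> hd B \<le> 1 \<and> last B \<ge> -1;
      successively (\<lambda>a b. b \<le> a + 1) B\<rbrakk> \<Longrightarrow>
     NU2_rel (dclass ([0,1] @ replicate k 2 @ B @ replicate k (-1)))
             (dclass ([0] @ replicate k 0 @ B @ [0] @ replicate k 1))"

text \<open>
  The partial map NU is given by its graph \<open>NU_rel\<close>, which is single-valued; the value of
  \<open>NU \<delta>\<close> is meaningful only for \<open>\<delta> \<in> NU_dom\<close>.
\<close>

definition NU_rel :: "int list set \<Rightarrow> int list set \<Rightarrow> bool" where
  "NU_rel \<delta> \<epsilon> \<longleftrightarrow>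
     (\<exists>p\<in>D1. \<delta> = ptn_class p \<and> \<epsilon> = ptn_class (NU1 p)) \<or> NU2_rel \<delta> \<epsilon>"

definition NU_dom :: "int list set set" where
  "NU_dom = {\<delta>. \<exists>\<epsilon>. NU_rel \<delta> \<epsilon>}"

definition NU :: "int list set \<Rightarrow> int list set" where
  "NU \<delta> = (THE \<epsilon>. NU_rel \<delta> \<epsilon>)"

definition NU_defined :: "int list set \<Rightarrow> nat \<Rightarrow> bool" where
  "NU_defined \<delta> i \<longleftrightarrow> (\<forall>k<i. (NU ^^ k) \<delta> \<in> NU_dom)"

definition NU_chain :: "int list set \<Rightarrow> int list set set" where
  "NU_chain \<delta> = {(NU ^^ i) \<delta> | i. NU_defined \<delta> i}"

text \<open>The values of \<open>min_delta\<close> on \<open>(NU ^^ i) \<delta>\<close> for \<open>a \<le> i < b\<close>.\<close>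

definition profile :: "int list set \<Rightarrow> nat \<Rightarrow> nat \<Rightarrow> nat list" where
  "profile \<delta> a b = map (\<lambda>i. min_delta ((NU ^^ i) \<delta>)) [a..<b]"

text \<open>
  \<open>stair_prefix L w\<close>: the finite word \<open>w\<close> is a prefix of the infinite word
  \<open>L (L+1)\<^sup>L (L+2)\<^sup>L\<^sup>+\<^sup>1 \<dots>\<close>, whose truncation after \<open>m\<close> blocks is \<open>stair_word L m\<close>.
\<close>

definition stair_word :: "nat \<Rightarrow> nat \<Rightarrow> nat list" where
  "stair_word L m = L # concat (map (\<lambda>t. replicate (L + t) (L + t + 1)) [0..<m])"

definition stair_prefix :: "nat \<Rightarrow> nat list \<Rightarrow> bool" where
  "stair_prefix L w \<longleftrightarrow> (\<exists>m. prefix w (stair_word L m))"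

section \<open>The objects TI and S\<close>

definition B_word :: "nat list \<Rightarrow> int list" where
  "B_word p = concat (map (\<lambda>k. 0 # replicate (count_list p k) 1) [1..<Suc (part p 1)])"

definition TI :: "nat list \<Rightarrow> int list set" where
  "TI p = dclass (0 # B_word p)"

definition initial_pos :: "int list \<Rightarrow> nat set" where
  "initial_pos v =
     {i. i > 0 \<and> NU_defined (dclass v) i \<and> NU1_initial ((NU ^^ i) (dclass v))}"

text \<open>
  \<open>S_pos v j\<close> is the position in the chain of the \<open>j\<close>-th \<open>S\<close>-vector. The definitions are
  intended for the case that \<open>initial_pos v\<close> is finite.
\<close>

definition S_pos :: "int list \<Rightarrow> nat \<Rightarrow> nat" where
  "S_pos v j = (0 # sorted_list_of_set (initial_pos v)) ! j"

definition S_num :: "int list \<Rightarrow> nat" where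
  "S_num v = card (initial_pos v)"

definition S_vec :: "int list \<Rightarrow> nat \<Rightarrow> int list" where
  "S_vec v j = (if j = 0 then v else reduced ((NU ^^ S_pos v j) (dclass v)))"

section \<open>The vectors in the theorem\<close>

definition even_count :: "(nat \<Rightarrow> nat) \<Rightarrow> nat \<Rightarrow> nat" where
  "even_count n i = card {k. k < i \<and> even (n k)}"

definition twos :: "(nat \<Rightarrow> nat) \<Rightarrow> nat \<Rightarrow> nat \<Rightarrow> int list" where
  "twos n a b = concat (map (\<lambda>k. 1 # replicate (n k) 2) [a..<b])"

definition tail_blocks :: "(nat \<Rightarrow> nat) \<Rightarrow> nat \<Rightarrow> int list" where
  "tail_blocks n i =
     concat (map (\<lambda>k. replicate (2 * (n k div 2)) 1 @ [0] @ replicate (n k mod 2) 1) [0..<i])"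

definition v_vec :: "nat \<Rightarrow> (nat \<Rightarrow> nat) \<Rightarrow> int list \<Rightarrow> nat \<Rightarrow> int list" where
  "v_vec r n C i =
     (if i \<le> r
      then [0,0] @ twos n i (Suc r) @ replicate (even_count n i) 1 @ C @ tail_blocks n i
      else [0,0] @ replicate (even_count n (Suc r)) 1 @ C @ tail_blocks n r
             @ replicate (2 * (n r div 2)) 1 @ concat (replicate (n r mod 2) [0,1]))"

definition mid_vec :: "nat \<Rightarrow> (nat \<Rightarrow> nat) \<Rightarrow> int list \<Rightarrow> nat \<Rightarrow> nat \<Rightarrow> int list" where
  "mid_vec r n C i c =
     [0,0,1] @ replicate (n i - 2 * c) 2 @ twos n (Suc i) (Suc r)
       @ replicate (even_count n i) 1 @ C @ tail_blocks n i @ replicate (2 * c) 1"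

definition form_00X1 :: "int list \<Rightarrow> bool" where
  "form_00X1 w \<longleftrightarrow> (\<exists>X. set X \<subseteq> {0,1,2} \<and> w = [0,0] @ X @ [1])"

end

theory Submission
  imports Defs
begin

text \<open>
  On vectors, \<open>NU1\<close> deletes the last entry \<open>m\<close> of the initial run \<open>0 1 \<dots> m\<close> and appends \<open>m - 1\<close>. Hence from
  \<open>00A\<close> (of length \<open>L\<close>) one passes to \<open>01A\<^sup>+0\<close> and then processes the letters of \<open>A\<close> from left to right,
  at constant length \<open>L + 1\<close>, unless a block \<open>12\<^sup>k\<close> with \<open>k > 0\<close> stands at the front: then one application
  of \<open>NU2\<close> returns to length \<open>L\<close>. So the chain is a concatenation of segments between vectors beginning
  with \<open>00\<close>. With \<open>D\<close> binary, the start \<open>0012\<^sup>k12\<^sup>l\<dots>D\<close> of a segment is followed by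
  \<^item> \<open>0012\<^sup>k\<^sup>-\<^sup>212\<^sup>l\<dots>D11\<close> if \<open>k \<ge> 2\<close>, with profile \<open>L, L+1, L\<close>;
  \<^item> \<open>0012\<^sup>l\<dots>D01\<close> if \<open>k = 1\<close>, with profile \<open>L, L+1, L\<close>;
  \<^item> \<open>0012\<^sup>l\<dots>1D0\<close> if \<open>k = 0\<close>, with profile \<open>L, (L+1)\<^sup>L\<close>.

  After \<open>[v]\<close>, the initial objects are exactly the ends of the segments of the first two kinds. Eventually all
  blocks are used up and the lengths grow without bound, so no object occurs twice in the chain.
\<close>

subsection \<open>Partitions and quasi-Dyck vectors\<close>

lemma qdv_conv_nth:
  "qdv v \<longleftrightarrow> v \<noteq> [] \<and> v ! 0 = 0 \<and> (\<forall>i. Suc i < length v \<longrightarrow> v ! Suc i \<le> v ! i + 1)"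
  unfolding qdv_def successively_conv_nth by (cases v) auto

section \<open>Zero-padded parts of a partition\<close>

lemma part_pos_iff:
  assumes "is_ptn p" "1 \<le> i"
  shows "0 < part p i \<longleftrightarrow> i \<le> length p"
proof -
  have "p ! (i - 1) \<in> set p" if "i \<le> length p" using that assms by (intro nth_mem) auto
  then have "0 < p ! (i - 1)" if "i \<le> length p"
    using that assms unfolding is_ptn_def by (metis gr0I)
  then show ?thesis using assms unfolding part_def by auto
qed

lemma part_antimono:
  assumes "sorted_wrt (\<ge>) p" "1 \<le> i" "i \<le> j"
  shows "part p j \<le> part p i"
proof (cases "i = j \<or> j > length p")
  case False
  then have "i - 1 < j - 1" "j - 1 < length p" using assms by auto
  from sorted_wrt_nth_less[OF assms(1) this] show ?thesis
    using assms False unfolding part_def by auto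
qed (auto simp: part_def)

lemma part_eqI:
  assumes "is_ptn p" "is_ptn q" "\<And>i. 1 \<le> i \<Longrightarrow> part p i = part q i"
  shows "p = q"
proof -
  have *: "i \<le> length p \<longleftrightarrow> i \<le> length q" if "1 \<le> i" for i
    using part_pos_iff[OF assms(1) that] part_pos_iff[OF assms(2) that] assms(3)[OF that] by simp
  have "length p = length q"
    using *[of "length p"] *[of "length q"]
    by (cases "length p = 0"; cases "length q = 0") auto
  moreover have "p ! i = q ! i" if "i < length p" for i
    using assms(3)[of "Suc i"] that calculation unfolding part_def by simp
  ultimately show ?thesis by (intro nth_equalityI) auto
qed

text \<open>In a weakly decreasing list the zeros form a suffix, so dropping them renumbers no
  positive part.\<close>

lemma part_filter_pos:
  assumes "sorted_wrt (\<ge>) p"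
  shows "part (filter (\<lambda>x. x > 0) p) i = part p i"
  using assms
proof (induction p arbitrary: i)
  case (Cons a p)
  show ?case
  proof (cases "a = 0")
    case True
    then have "\<forall>x\<in>set (a # p). x = 0" using Cons.prems by auto
    then have "filter (\<lambda>x. x > 0) (a # p) = []" "\<And>j. j < length (a # p) \<Longrightarrow> (a # p) ! j = 0"
      using nth_mem[of _ "a # p"] by (auto simp: filter_empty_conv)
    then show ?thesis unfolding part_def by (auto simp del: filter.simps)
  next
    case False
    have "part (a # xs) i = (if i = 0 then 0 else if i = 1 then a else part xs (i - 1))" for xs i
      unfolding part_def by (auto simp: nth_Cons' diff_diff_left)
    then show ?thesis using Cons False by simp
  qed
qed simp

lemma is_ptn_filter_pos:
  "sorted_wrt (\<ge>) p \<Longrightarrow> is_ptn (filter (\<lambda>x. x > 0) p)"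
  unfolding is_ptn_def by (auto intro: sorted_wrt_filter)

lemma length_qdv_of [simp]: "length (qdv_of n p) = n"
  by (simp add: qdv_of_def)

lemma nth_qdv_of: "j < n \<Longrightarrow> qdv_of n p ! j = int j - int (part p (n - j))"
  by (simp add: qdv_of_def)

lemma part_beyond: "i > length p \<Longrightarrow> part p i = 0"
  by (simp add: part_def)

lemma qdv_qdv_of:
  assumes "is_ptn p" "n > length p"
  shows "qdv (qdv_of n p)"
proof -
  have "qdv_of n p ! Suc i \<le> qdv_of n p ! i + 1" if "Suc i < n" for i
    using that part_antimono[of p "n - Suc i" "n - i"] assms(1)
    by (auto simp: nth_qdv_of is_ptn_def)
  moreover have "qdv_of n p \<noteq> []" using assms by (auto simp: qdv_of_def)
  ultimately show ?thesis using assms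
    unfolding qdv_conv_nth by (simp add: nth_qdv_of part_beyond)
qed

section \<open>Reading a partition off a quasi-Dyck vector\<close>

lemma qdv_nth_le: "qdv w \<Longrightarrow> j < length w \<Longrightarrow> w ! j \<le> int j"
proof (induction j)
  case (Suc j)
  then have "w ! Suc j \<le> w ! j + 1" unfolding qdv_conv_nth by auto
  with Suc show ?case by auto
qed (simp add: qdv_conv_nth)

text \<open>By \<open>nth_qdv_of\<close>, position minus entry is the part with index
  \<open>n - i\<close>; the growth condition on \<open>w\<close> is exactly the monotonicity of
  these parts.\<close>

lemma qdv_antimono_diff:
  assumes "qdv w" "i \<le> j" "j < length w"
  shows "int i - w ! i \<le> int j - w ! j"
  using assms(2,3)
proof (induction j)
  case (Suc j)
  show ?case
  proof (cases "i = Suc j")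
    case False
    moreover have "w ! Suc j \<le> w ! j + 1" using assms Suc unfolding qdv_conv_nth by auto
    ultimately show ?thesis using Suc by auto
  qed simp
qed simp

lemma qdv_obtain_ptn:
  assumes "qdv w"
  obtains p where "is_ptn p" "length p < length w" "w = qdv_of (length w) p"
proof -
  define n where "n = length w"
  have "n > 0" using assms by (auto simp: n_def qdv_def)
  \<comment> \<open>Candidate for part number \<open>i\<close>, found by solving
    \<open>nth_qdv_of\<close> for the part; \<open>nat\<close> loses nothing because no entry
    exceeds its position.\<close>
  define g where "g i = nat (int (n - i) - w ! (n - i))" for i
  \<comment> \<open>The index \<open>n\<close> is left out: there the first entry 0 gives part 0,
    and the omission yields \<open>length p < n\<close>.\<close>
  define q where "q = map g [1..<n]"
  define p where "p = filter (\<lambda>x. x > 0) q"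
  have sq: "sorted_wrt (\<ge>) q"
    unfolding q_def sorted_wrt_map
  proof (rule sorted_wrt_mono_rel[OF _ sorted_wrt_upt])
    fix i j assume "i \<in> set [1..<n]" "j \<in> set [1..<n]" "i < j"
    then show "g j \<le> g i"
      using qdv_antimono_diff[OF assms, of "n - j" "n - i"] unfolding g_def
      by (intro nat_mono) (auto simp: n_def)
  qed
  have "length p \<le> length q" unfolding p_def by (rule length_filter_le)
  then have len: "length p < n" using \<open>n > 0\<close> by (auto simp: q_def)
  have part_p: "part p i = g i" if "1 \<le> i" "i \<le> n" for i
  proof (cases "i = n")
    case True
    then show ?thesis using len assms by (simp add: part_beyond g_def qdv_conv_nth)
  next
    case False
    then show ?thesis using that unfolding p_def part_filter_pos[OF sq]
      by (auto simp: part_def q_def)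
  qed
  have "w = qdv_of n p"
  proof (rule nth_equalityI)
    fix j assume "j < length w"
    then have "1 \<le> n - j" "n - j \<le> n" "j < n" "n - (n - j) = j" by (auto simp: n_def)
    then show "w ! j = qdv_of n p ! j"
      using part_p[of "n - j"] qdv_nth_le[OF assms \<open>j < length w\<close>]
      by (simp add: nth_qdv_of g_def)
  qed (simp add: n_def)
  moreover have "is_ptn p" unfolding p_def by (rule is_ptn_filter_pos[OF sq])
  ultimately show ?thesis using that len by (simp add: n_def)
qed

lemma qdv_of_inject:
  assumes "is_ptn p" "is_ptn q" "n > length p" "n > length q" "qdv_of n p = qdv_of n q"
  shows "p = q"
proof (rule part_eqI[OF assms(1,2)])
  fix i :: nat assume "1 \<le> i"
  show "part p i = part q i"
  proof (cases "i \<le> n")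
    case True
    then have "n - i < n" "n - (n - i) = i" using \<open>1 \<le> i\<close> by auto
    then show ?thesis using assms(5) nth_qdv_of[of "n - i" n p] nth_qdv_of[of "n - i" n q] by simp
  next
    case False
    then show ?thesis using assms by (simp add: part_beyond)
  qed
qed

lemma qdv_of_Suc:
  assumes "n > length p"
  shows "qdv_of (Suc n) p = 0 # map (\<lambda>x. x + 1) (qdv_of n p)"
proof (rule nth_equalityI)
  fix j assume "j < length (qdv_of (Suc n) p)"
  then show "qdv_of (Suc n) p ! j = (0 # map (\<lambda>x. x + 1) (qdv_of n p)) ! j"
    using assms by (cases j) (auto simp: nth_qdv_of part_beyond)
qed simp

subsection \<open>Dyck classes and reduced vectors\<close>

lemma dyck_step_qdv_of:
  "is_ptn p \<Longrightarrow> n > length p \<Longrightarrow> dyck_step (qdv_of n p) (qdv_of (Suc n) p)"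
  by (simp add: dyck_step_def qdv_qdv_of qdv_of_Suc)

text \<open>Handles the backward steps of the generated equivalence: the predecessor comes from some
  partition \<open>q\<close>, and shifting it forward again forces \<open>q = p\<close>.\<close>

lemma dyck_step_into_qdv_of:
  assumes "dyck_step u (qdv_of n p)" "is_ptn p" "n > length p"
  shows "\<exists>m>length p. u = qdv_of m p"
proof -
  have u: "qdv u" "qdv_of n p = 0 # map (\<lambda>x. x + 1) u" using assms by (auto simp: dyck_step_def)
  obtain q where q: "is_ptn q" "length q < length u" "u = qdv_of (length u) q"
    using qdv_obtain_ptn[OF u(1)] .
  have "qdv_of (Suc (length u)) q = qdv_of n p"
    using qdv_of_Suc[OF q(2)] q(3) u(2) by simp
  moreover have "Suc (length u) = n" using calculation length_qdv_of by metis
  ultimately have "q = p" using q(2) assms(3)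
    by (intro qdv_of_inject[OF q(1) assms(2), of n]) auto
  then show ?thesis using q by auto
qed

lemma equivclp_qdv_of:
  assumes "is_ptn p" "n > length p"
  shows "equivclp dyck_step (qdv_of (Suc (length p)) p) (qdv_of n p)"
  using assms(2)
proof (induction n)
  case (Suc n)
  show ?case
  proof (cases "n = length p")
    case False
    then have n: "n > length p" using Suc.prems by simp
    show ?thesis
      by (rule equivclp_into_equivclp[OF Suc.IH[OF n]]) (use dyck_step_qdv_of[OF assms(1) n] in simp)
  qed simp
qed simp

text \<open>The representatives of \<open>p\<close> are closed under steps in both directions, and
  each of them is linked to the shortest one, \<open>qdv_of (Suc (length p)) p\<close>.\<close>

lemma dclass_qdv_of:
  assumes "is_ptn p" "n > length p"
  shows "dclass (qdv_of n p) = ptn_class p"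
proof (intro equalityI subsetI)
  fix w assume "w \<in> dclass (qdv_of n p)"
  then have "equivclp dyck_step (qdv_of n p) w" by (simp add: dclass_def)
  then have "\<exists>m>length p. w = qdv_of m p"
  proof (induction w rule: equivclp_induct)
    case base
    then show ?case using assms by auto
  next
    case (step y z)
    then obtain m where m: "m > length p" "y = qdv_of m p" by auto
    from step(2) show ?case
    proof
      assume "dyck_step y z"
      then have "z = qdv_of (Suc m) p" using m by (simp add: dyck_step_def qdv_of_Suc)
      then show ?thesis using m by (intro exI[of _ "Suc m"]) auto
    next
      assume "dyck_step z y"
      then show ?thesis using dyck_step_into_qdv_of assms m by auto
    qed
  qed
  then show "w \<in> ptn_class p" by (auto simp: ptn_class_def)
next
  fix w assume "w \<in> ptn_class p"
  then obtain m where "m > length p" "w = qdv_of m p" by (auto simp: ptn_class_def)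
  then show "w \<in> dclass (qdv_of n p)"
    using equivclp_qdv_of[OF assms] equivclp_qdv_of[OF assms(1), of m]
    unfolding dclass_def by (metis equivclp_sym equivclp_trans mem_Collect_eq)
qed

lemma ptn_class_inject:
  assumes "is_ptn p" "is_ptn q" "ptn_class p = ptn_class q"
  shows "p = q"
proof -
  define n where "n = Suc (length p + length q)"
  have "qdv_of n p \<in> ptn_class p" unfolding ptn_class_def n_def by auto
  then have "qdv_of n p \<in> ptn_class q" using assms(3) by simp
  then obtain m where m: "m > length q" "qdv_of n p = qdv_of m q" by (auto simp: ptn_class_def)
  then have "m = n" by (metis length_qdv_of)
  then show ?thesis using qdv_of_inject[OF assms(1,2), of n] m by (auto simp: n_def)
qed

lemma ptn_of_ptn_class: "is_ptn p \<Longrightarrow> ptn_of (ptn_class p) = p"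
  unfolding ptn_of_def by (rule the_equality) (auto intro: ptn_class_inject)

lemma dclass_eq_of_shift:
  assumes "qdv w"
  shows "dclass (0 # map (\<lambda>x. x + 1) w) = dclass w"
proof -
  obtain p where p: "is_ptn p" "length p < length w" "w = qdv_of (length w) p"
    using qdv_obtain_ptn[OF assms] .
  have "0 # map (\<lambda>x. x + 1) w = qdv_of (Suc (length w)) p"
    using qdv_of_Suc[OF p(2)] p(3) by simp
  then show ?thesis using dclass_qdv_of[OF p(1)] p(2,3) by (metis less_SucI)
qed

lemma dclass_eq_same_length:
  assumes "qdv u" "qdv w" "dclass u = dclass w" "length u = length w"
  shows "u = w"
proof -
  obtain p where p: "is_ptn p" "length p < length u" "u = qdv_of (length u) p"
    using qdv_obtain_ptn[OF assms(1)] .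
  obtain q where q: "is_ptn q" "length q < length w" "w = qdv_of (length w) q"
    using qdv_obtain_ptn[OF assms(2)] .
  have "ptn_class p = ptn_class q"
    using dclass_qdv_of[OF p(1,2)] dclass_qdv_of[OF q(1,2)] p(3) q(3) assms(3) by simp
  then show ?thesis using ptn_class_inject[OF p(1) q(1)] p q assms(4) by metis
qed

text \<open>A Dyck vector is reduced iff it is not of the form \<open>0w\<^sup>+\<close> with \<open>w\<close> a Dyck vector; a zero
  after the first entry certifies this.\<close>

definition red :: "int list \<Rightarrow> bool" where
  "red w \<longleftrightarrow> dyck w \<and> 0 \<in> set (tl w)"

text \<open>If a shorter representative were nonnegative, every longer one would be 0 followed by
  nonnegative entries raised by 1. Then \<open>w\<close> would have no 0 after its first entry,
  against \<open>red\<close>.\<close>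

lemma red_min_delta:
  assumes "red w"
  shows "min_delta (dclass w) = length w" "reduced (dclass w) = w"
proof -
  have "qdv w" and nonneg: "\<forall>x\<in>set w. x \<ge> 0" using assms by (auto simp: red_def dyck_def)
  obtain p where p: "is_ptn p" "length p < length w" "w = qdv_of (length w) p"
    using qdv_obtain_ptn[OF \<open>qdv w\<close>] .
  have cls: "ptn_of (dclass w) = p"
    using dclass_qdv_of[OF p(1,2)] p(1,3) ptn_of_ptn_class by metis
  show md: "min_delta (dclass w) = length w"
    unfolding min_delta_def cls
  proof (rule Least_equality)
    show "length w > length p \<and> (\<forall>x\<in>set (qdv_of (length w) p). x \<ge> 0)" using p nonneg by simp
  next
    fix m assume m: "m > length p \<and> (\<forall>x\<in>set (qdv_of m p). x \<ge> 0)"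
    show "length w \<le> m"
    proof (rule ccontr)
      assume "\<not> length w \<le> m"
      then have "m < length w" by simp
      have shift: "qdv_of (Suc k) p = 0 # map (\<lambda>x. x + 1) (qdv_of k p)" if "m \<le> k" for k
        using m that by (intro qdv_of_Suc) auto
      have pos: "\<forall>x\<in>set (qdv_of k p). x \<ge> 0" if "m \<le> k" for k
        using that
      proof (induction k rule: dec_induct)
        case (step k)
        then show ?case unfolding shift[OF step(1)] by fastforce
      qed (use m in simp)
      obtain k where k: "length w = Suc k" "m \<le> k"
        using \<open>m < length w\<close> by (cases "length w") auto
      have "tl w = map (\<lambda>x. x + 1) (qdv_of k p)"
        using p(3) shift[OF k(2)] k(1) by (metis list.sel(3))
      moreover have "\<forall>x\<in>set (qdv_of k p). x \<ge> 0" using pos k by blast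
      ultimately have "0 \<notin> set (tl w)" by auto
      then show False using assms by (simp add: red_def)
    qed
  qed
  show "reduced (dclass w) = w" unfolding reduced_def md cls using p(3) by simp
qed

subsection \<open>The map NU on vectors\<close>

text \<open>Along the initial run \<open>0 1 .. m\<close> each entry equals its position, so the
  corresponding parts vanish. The next entry lies below its position, and from there on all parts
  are positive. Hence the parts are counted by the letters after the run.\<close>

lemma length_ptn_of_leader:
  assumes p: "is_ptn p" "n > length p" and w: "qdv_of n p = map int [0..<Suc m] @ A"
    and A: "A = [] \<or> hd A \<le> int m"
  shows "length p = length A" "n = length A + Suc m"
proof -
  show n: "n = length A + Suc m" using arg_cong[OF w, of length] by simp
  have "n - m > length p"
  proof (rule ccontr)
    assume "\<not> n - m > length p"
    moreover have "qdv_of n p ! m = int m" unfolding w by (simp add: nth_append)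
    then have "part p (n - m) = 0" using n nth_qdv_of[of m n p] by simp
    ultimately show False using part_pos_iff[OF p(1), of "n - m"] n by auto
  qed
  moreover have "length A \<le> length p"
  proof (cases A)
    case (Cons a A')
    then have "qdv_of n p ! Suc m = a" unfolding w by (simp add: nth_append)
    then have "part p (n - Suc m) > 0" using n Cons A nth_qdv_of[of "Suc m" n p] by simp
    then show ?thesis using part_pos_iff[OF p(1), of "n - Suc m"] n Cons by auto
  qed simp
  ultimately show "length p = length A" using n by simp
qed

section \<open>\<open>NU1\<close> as an operation on vectors\<close>

lemma part_Cons: "part (a # xs) i = (if i = 0 then 0 else if i = 1 then a else part xs (i - 1))"
  unfolding part_def by (auto simp: nth_Cons' diff_diff_left)

text \<open>The order of the parts is where \<open>D1\<close> enters: it gives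
  \<open>part p 1 - 1 <= length p + 1\<close>, so the new first part dominates the old ones lowered
  by 1.\<close>

lemma NU1_props:
  assumes "p \<in> D1"
  shows "is_ptn (NU1 p)" "part (NU1 p) 1 = length p + 1" "length (NU1 p) \<le> length p + 1"
    and "\<And>i. i \<ge> 2 \<Longrightarrow> part (NU1 p) i = part p (i - 1) - 1"
proof -
  define q where "q = map (\<lambda>x. x - 1) p"
  have s: "sorted_wrt (\<ge>) p" and d: "part p 1 \<le> length p + 2"
    using assms by (auto simp: D1_def is_ptn_def)
  have sq: "sorted_wrt (\<ge>) q" unfolding q_def sorted_wrt_map
    by (rule sorted_wrt_mono_rel[OF _ s]) simp
  have NU: "NU1 p = (length p + 1) # filter (\<lambda>x. x > 0) q" by (simp add: NU1_def q_def)
  have q: "part q i = part p i - 1" for i by (auto simp: part_def q_def)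
  have "x \<le> part p 1 - 1" if x: "x \<in> set q" for x
  proof -
    obtain i where "i < length q" "x = q ! i" using x by (metis in_set_conv_nth)
    then have "x = part q (Suc i)" by (simp add: part_def)
    also have "\<dots> \<le> part q 1" using sq by (intro part_antimono) auto
    finally show ?thesis by (simp add: q)
  qed
  moreover have "length (filter (\<lambda>x. x > 0) q) \<le> length q" by (rule length_filter_le)
  ultimately show "is_ptn (NU1 p)" "length (NU1 p) \<le> length p + 1"
    using is_ptn_filter_pos[OF sq] d unfolding NU is_ptn_def by (force simp: q_def)+
  show "part (NU1 p) 1 = length p + 1" unfolding NU by (simp add: part_Cons)
  show "part (NU1 p) i = part p (i - 1) - 1" if "i \<ge> 2" for i
    using that unfolding NU by (simp add: part_Cons part_filter_pos[OF sq] q)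
qed

text \<open>Since \<open>length p = length A\<close>, the bound on \<open>last w\<close> is the
  condition \<open>D1\<close>. At equal vector length each part moves to the next index and drops by
  1, so its entry moves one place to the left unchanged; the new first part
  \<open>length p + 1\<close> produces the final entry \<open>m - 1\<close>.\<close>

lemma NU1_vector:
  assumes w: "qdv w" "w = map int [0..<m] @ [int m] @ A" and m: "m \<ge> 1"
    and A: "A = [] \<or> hd A \<le> int m" and last: "last w \<ge> int m - 2"
  defines "u \<equiv> map int [0..<m] @ A @ [int m - 1]"
  obtains p where "p \<in> D1" "dclass w = ptn_class p" "dclass u = ptn_class (NU1 p)" "qdv u"
proof -
  obtain p where p: "is_ptn p" "length p < length w" "w = qdv_of (length w) p"
    using qdv_obtain_ptn[OF w(1)] .
  define n where "n = length w"
  have wn: "qdv_of n p = w" using p(3) by (simp add: n_def)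
  have "qdv_of n p = map int [0..<Suc m] @ A" unfolding wn w(2) by simp
  from length_ptn_of_leader[OF p(1) _ this A] have lp: "length p = length A"
    and n: "n = length A + Suc m" using p(2) by (auto simp: n_def)
  have "last w = w ! (n - 1)" using n by (simp add: n_def last_conv_nth w(2))
  also have "\<dots> = int (n - 1) - int (part p 1)"
    using nth_qdv_of[of "n - 1" n p] n wn by simp
  finally have "part p 1 \<le> length p + 2" using last n lp by simp
  then have D1: "p \<in> D1" using p(1) by (simp add: D1_def)
  have lu: "length u = n" by (simp add: u_def n)
  have "u = qdv_of n (NU1 p)"
  proof (rule nth_equalityI)
    fix j assume "j < length u"
    then have j: "j < n" using lu by simp
    have *: "qdv_of n (NU1 p) ! j = int j - int (part (NU1 p) (n - j))"
      using j by (rule nth_qdv_of)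
    consider "j < m" | "m \<le> j" "j < n - 1" | "j = n - 1" using j by linarith
    then show "u ! j = qdv_of n (NU1 p) ! j"
    proof cases
      case 1
      then have "n - j > length (NU1 p)" using NU1_props(3)[OF D1] lp n by simp
      then show ?thesis using 1 unfolding * by (simp add: part_beyond u_def nth_append)
    next
      case 2
      then have nj: "n - j \<ge> 2" "n - j - 1 \<le> length p" "Suc j < n"
        using n lp by auto
      \<comment> \<open>Positivity makes the truncated subtraction in \<open>NU1\<close>
        exact.\<close>
      then have "part p (n - j - 1) > 0" using part_pos_iff[OF p(1), of "n - j - 1"] by simp
      moreover have "w ! Suc j = int (Suc j) - int (part p (n - j - 1))"
        using nth_qdv_of[of "Suc j" n p] wn nj by simp
      moreover have "w ! Suc j = u ! j"
      proof -
        have "j - m < length A" using 2 n by auto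
        then show ?thesis using 2 by (simp add: w(2) u_def nth_append Suc_diff_le)
      qed
      ultimately show ?thesis unfolding * NU1_props(4)[OF D1 nj(1)] by simp
    next
      case 3
      then have "n - j = 1" using n by simp
      then show ?thesis unfolding * using 3 n lp
        by (simp add: NU1_props(2)[OF D1, simplified] u_def nth_append)
    qed
  qed (simp add: lu)
  moreover have "length (NU1 p) < n" using NU1_props(3)[OF D1] n m lp by simp
  ultimately have "dclass u = ptn_class (NU1 p)" "qdv u"
    using dclass_qdv_of[OF NU1_props(1)[OF D1]] qdv_qdv_of[OF NU1_props(1)[OF D1]] by auto
  moreover have "dclass w = ptn_class p" using dclass_qdv_of[OF p(1,2)] p(3) by simp
  ultimately show ?thesis using that D1 by blast
qed

text \<open>The run stops at 2, which fixes the length in terms of \<open>length p\<close>. The last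
  entry -1 makes the first part equal to the length of \<open>z\<close>, one more than
  \<open>D1\<close> admits.\<close>

lemma not_D1_of_leader:
  assumes "qdv z" "z = [0,1,2] @ Y" "Y \<noteq> []" "hd Y \<le> 2" "last Y = -1"
    and p: "is_ptn p" "dclass z = ptn_class p"
  shows "p \<notin> D1" "length z = length p + 3"
proof -
  obtain q where q: "is_ptn q" "length q < length z" "z = qdv_of (length z) q"
    using qdv_obtain_ptn[OF assms(1)] .
  have "q = p" using dclass_qdv_of[OF q(1,2)] q(3) p ptn_class_inject[OF q(1) p(1)] by simp
  define n where "n = length z"
  have zn: "qdv_of n p = z" using q \<open>q = p\<close> by (simp add: n_def)
  have "qdv_of n p = map int [0..<Suc 2] @ Y" unfolding zn assms(2)
    by (simp add: eval_nat_numeral)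
  from length_ptn_of_leader[OF p(1) _ this] have lp: "length p = length Y"
    and n: "n = length Y + Suc 2" using q(2) \<open>q = p\<close> assms(4) by (auto simp: n_def)
  have "last z = z ! (n - 1)" using n by (simp add: n_def last_conv_nth assms(2))
  also have "\<dots> = int (n - 1) - int (part p 1)"
    using nth_qdv_of[of "n - 1" n p] n zn by simp
  finally have "part p 1 = n" using assms(2,3,5) n by simp
  then show "p \<notin> D1" using lp n by (simp add: D1_def)
  show "length z = length p + 3" using lp n by (simp add: n_def)
qed

section \<open>\<open>NU2\<close> on vectors and single-valuedness of \<open>NU\<close>\<close>

lemma successively_replicate: "P x x \<Longrightarrow> successively P (replicate n x)"
proof (induction n)
  case (Suc n)
  then show ?case by (cases n) auto
qed simp

text \<open>Both rules are brought to the common leader \<open>012\<close>, with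
  \<open>h = Suc (Suc g)\<close> and \<open>k = Suc g\<close>, so that one uniqueness argument
  serves for both.\<close>

lemma NU2_rel_vector:
  assumes "NU2_rel \<delta> \<epsilon>"
  obtains
    (a) g A where "\<delta> = dclass ([0,1,2] @ (replicate (Suc g) 2 @ A @ replicate (Suc g) (-1)))"
      "\<epsilon> = dclass ([0] @ replicate (Suc g) 0 @ [1] @ A @ replicate (Suc (Suc g)) 1)"
      "A = [] \<or> last A \<ge> 0"
      "qdv ([0,1,2] @ (replicate (Suc g) 2 @ A @ replicate (Suc g) (-1)))"
  | (b) g B where "\<delta> = dclass ([0,1,2] @ (replicate g 2 @ B @ replicate (Suc g) (-1)))"
      "\<epsilon> = dclass ([0] @ replicate (Suc g) 0 @ B @ [0] @ replicate (Suc g) 1)"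
      "B = [] \<or> hd B \<le> 1"
      "qdv ([0,1,2] @ (replicate g 2 @ B @ replicate (Suc g) (-1)))"
  using assms
proof cases
  case (rule_a h A)
  then have "h = Suc (Suc (h - 2))" by simp
  then obtain g where h: "h = Suc (Suc g)" by blast
  have "A = [] \<or> hd A \<le> 2" using rule_a(4) by (cases A) auto
  then have "qdv ([0,1,2] @ (replicate (Suc g) 2 @ A @ replicate (Suc g) (-1)))"
    using rule_a unfolding qdv_def
    by (auto simp: successively_append_iff successively_Cons hd_append successively_replicate h
        simp del: replicate_Suc)
  then show ?thesis using rule_a a[of g A] by (simp add: h)
next
  case (rule_b k B)
  then obtain g where k: "k = Suc g" by (cases k) auto
  have "qdv ([0,1,2] @ (replicate g 2 @ B @ replicate (Suc g) (-1)))"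
    using rule_b unfolding qdv_def
    by (cases "g = 0")
      (auto simp: successively_append_iff successively_Cons hd_append successively_replicate k
        simp del: replicate_Suc)
  then show ?thesis using rule_b b[of g B] by (auto simp add: k)
qed

lemma replicate_Suc_snoc: "replicate (Suc n) x = replicate n x @ [x]"
  by (simp add: replicate_append_same)

lemma NU2_rel_leader:
  assumes "NU2_rel \<delta> \<epsilon>"
  obtains Y where "\<delta> = dclass ([0,1,2] @ Y)" "qdv ([0,1,2] @ Y)" "Y \<noteq> []" "hd Y \<le> 2" "last Y = -1"
  using assms
proof (cases rule: NU2_rel_vector)
  case (a g A)
  then show ?thesis using that by fastforce
next
  case (b g B)
  then show ?thesis
    using that[of "replicate g 2 @ B @ replicate (Suc g) (-1)"]
    by (cases g; cases "B = []") auto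
qed

lemma NU_eqI:
  assumes "NU_rel \<delta> \<epsilon>" "\<And>\<eta>. NU_rel \<delta> \<eta> \<Longrightarrow> \<eta> = \<epsilon>"
  shows "NU \<delta> = \<epsilon>" "\<delta> \<in> NU_dom"
proof -
  show "NU \<delta> = \<epsilon>" unfolding NU_def using assms by (rule the_equality)
  show "\<delta> \<in> NU_dom" using assms(1) by (auto simp: NU_dom_def)
qed

text \<open>The value is unique because the class determines the partition and because a source of
  \<open>NU2_rel\<close> lies outside \<open>D1\<close> by its leader.\<close>

lemma NU_of_D1:
  assumes "p \<in> D1"
  shows "NU (ptn_class p) = ptn_class (NU1 p)" "ptn_class p \<in> NU_dom"
proof -
  have p: "is_ptn p" using assms by (simp add: D1_def)
  have rel: "NU_rel (ptn_class p) (ptn_class (NU1 p))" using assms by (auto simp: NU_rel_def)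
  have "\<epsilon> = ptn_class (NU1 p)" if "NU_rel (ptn_class p) \<epsilon>" for \<epsilon>
    using that unfolding NU_rel_def
  proof
    assume "\<exists>q\<in>D1. ptn_class p = ptn_class q \<and> \<epsilon> = ptn_class (NU1 q)"
    then show ?thesis using ptn_class_inject p by (auto simp: D1_def)
  next
    assume "NU2_rel (ptn_class p) \<epsilon>"
    then obtain Y where "ptn_class p = dclass ([0,1,2] @ Y)" "qdv ([0,1,2] @ Y)" "Y \<noteq> []" "hd Y \<le> 2"
      "last Y = -1" by (rule NU2_rel_leader)
    then show ?thesis using not_D1_of_leader(1)[of _ Y p] p assms by auto
  qed
  then show "NU (ptn_class p) = ptn_class (NU1 p)" "ptn_class p \<in> NU_dom"
    using NU_eqI[OF rel] by blast+
qed

text \<open>Vectors of the shape occurring in the two rules are determined by their class, because the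
  length of the initial run \<open>0 1 2\<close> is fixed.\<close>

lemma NU_of_NU2_rel:
  assumes rel: "NU2_rel (dclass ([0,1,2] @ Y)) \<epsilon>"
    and Y: "qdv ([0,1,2] @ Y)" "Y \<noteq> []" "hd Y \<le> 2" "last Y = -1"
    and a: "\<And>g A. \<lbrakk>Y = replicate (Suc g) 2 @ A @ replicate (Suc g) (-1); A = [] \<or> last A \<ge> 0\<rbrakk> \<Longrightarrow>
      dclass ([0] @ replicate (Suc g) 0 @ [1] @ A @ replicate (Suc (Suc g)) 1) = \<epsilon>"
    and b: "\<And>g B. \<lbrakk>Y = replicate g 2 @ B @ replicate (Suc g) (-1); B = [] \<or> hd B \<le> 1\<rbrakk> \<Longrightarrow>
      dclass ([0] @ replicate (Suc g) 0 @ B @ [0] @ replicate (Suc g) 1) = \<epsilon>"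
  shows "NU (dclass ([0,1,2] @ Y)) = \<epsilon>" "dclass ([0,1,2] @ Y) \<in> NU_dom"
proof -
  let ?z = "[0,1,2] @ Y"
  obtain p where p: "is_ptn p" "length p < length ?z" "?z = qdv_of (length ?z) p"
    using qdv_obtain_ptn[OF Y(1)] .
  have cl: "dclass ?z = ptn_class p" using dclass_qdv_of[OF p(1,2)] p(3) by simp
  note nD1 = not_D1_of_leader[OF Y(1) refl Y(2-4) p(1) cl]
  have Y_eq: "Y = Y'" if Y': "dclass ([0,1,2] @ Y) = dclass ([0,1,2] @ Y')" "qdv ([0,1,2] @ Y')"
    "Y' \<noteq> []" "hd Y' \<le> 2" "last Y' = -1" for Y'
  proof -
    have "length ([0,1,2] @ Y') = length p + 3"
      using not_D1_of_leader(2)[OF Y'(2) refl Y'(3-5) p(1)] cl Y'(1) by simp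
    then have "length ?z = length ([0,1,2] @ Y')" using nD1(2) by simp
    from dclass_eq_same_length[OF Y(1) Y'(2,1) this] show ?thesis by simp
  qed
  have uniq: "\<eta> = \<epsilon>" if "NU_rel (dclass ?z) \<eta>" for \<eta>
  proof -
    have "NU2_rel (dclass ?z) \<eta>"
      using that nD1(1) cl ptn_class_inject[OF p(1)] unfolding NU_rel_def by (auto simp: D1_def)
    then show ?thesis
    proof (cases rule: NU2_rel_vector)
      case (a g A)
      have "Y = replicate (Suc g) 2 @ A @ replicate (Suc g) (-1)"
        by (rule Y_eq[OF a(1,4)]) auto
      from assms(6)[OF this a(3)] a(2) show ?thesis by simp
    next
      case (b g B)
      have "Y = replicate g 2 @ B @ replicate (Suc g) (-1)"
        by (rule Y_eq[OF b(1,4)]) (use b(3) in \<open>cases g; cases "B = []"; auto\<close>)+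
      from assms(7)[OF this b(3)] b(2) show ?thesis by simp
    qed
  qed
  have "NU_rel (dclass ?z) \<epsilon>" using rel by (simp add: NU_rel_def)
  from NU_eqI[OF this] uniq show "NU (dclass ?z) = \<epsilon>" "dclass ?z \<in> NU_dom" by blast+
qed

text \<open>The case \<open>h = 2\<close>. As \<open>A\<close> is nonnegative, only one -1 stands at
  the end, so either rule can match only with \<open>g = 0\<close>; for rule (b) the word
  \<open>B\<close> would then begin with 2.\<close>

lemma NU_rule_a:
  assumes A: "\<forall>x\<in>set A. 0 \<le> x \<and> x \<le> 2" "successively (\<lambda>a b. b \<le> a + 1) A"
  shows "NU (dclass ([0,1,2,2] @ A @ [-1])) = dclass ([0,0,1] @ A @ [1,1])"
    and "dclass ([0,1,2,2] @ A @ [-1]) \<in> NU_dom"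
proof -
  let ?Y = "2 # A @ [-1]"
  have A2: "A = [] \<or> hd A \<le> 2" "A = [] \<or> last A \<ge> 0" using A by (cases A; auto)+
  have rel: "NU2_rel (dclass ([0,1,2] @ ?Y)) (dclass ([0,0,1] @ A @ [1,1]))"
    using NU2_rel.rule_a[of 2 A] A A2 by (simp add: numeral_2_eq_2)
  have q: "qdv ([0,1,2] @ ?Y)"
    using A A2 by (auto simp: qdv_def successively_append_iff successively_Cons hd_append)
  have a: "dclass ([0] @ replicate (Suc g) 0 @ [1] @ A' @ replicate (Suc (Suc g)) 1)
      = dclass ([0,0,1] @ A @ [1,1])"
    if Y: "?Y = replicate (Suc g) 2 @ A' @ replicate (Suc g) (-1)" "A' = [] \<or> last A' \<ge> 0"
    for g A'
  proof -
    from Y(1) have "A = replicate g 2 @ A' @ replicate g (-1)"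
      unfolding replicate_Suc_snoc[of g "-1"] by simp
    moreover have "g = 0"
    proof (rule ccontr)
      assume "g \<noteq> 0"
      then have "-1 \<in> set A" using calculation by (cases g) auto
      then show False using A by auto
    qed
    ultimately show ?thesis by simp
  qed
  have b: "dclass ([0] @ replicate (Suc g) 0 @ B @ [0] @ replicate (Suc g) 1)
      = dclass ([0,0,1] @ A @ [1,1])"
    if Y: "?Y = replicate g 2 @ B @ replicate (Suc g) (-1)" "B = [] \<or> hd B \<le> 1" for g B
  proof -
    from Y(1) have "2 # A = replicate g 2 @ B @ replicate g (-1)"
      unfolding replicate_Suc_snoc[of g "-1"] by simp
    moreover have "g \<noteq> 0" using Y(2) calculation by (cases g; cases B) auto
    ultimately have "-1 \<in> set (2 # A)" by auto
    then show ?thesis using A by auto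
  qed
  show "NU (dclass ([0,1,2,2] @ A @ [-1])) = dclass ([0,0,1] @ A @ [1,1])"
    "dclass ([0,1,2,2] @ A @ [-1]) \<in> NU_dom"
    using NU_of_NU2_rel[OF rel q _ _ _ a b] by auto
qed

text \<open>The case \<open>k = 1\<close>. Rule (a) would force \<open>B\<close> to begin with 2,
  and a longer final run of -1 is excluded since \<open>B\<close> is nonnegative.\<close>

lemma NU_rule_b:
  assumes B: "\<forall>x\<in>set B. 0 \<le> x \<and> x \<le> 2" "successively (\<lambda>a b. b \<le> a + 1) B" "B = [] \<or> hd B \<le> 1"
  shows "NU (dclass ([0,1,2] @ B @ [-1])) = dclass ([0,0] @ B @ [0,1])"
    and "dclass ([0,1,2] @ B @ [-1]) \<in> NU_dom"
proof -
  let ?Y = "B @ [-1]"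
  have B2: "B = [] \<or> last B \<ge> 0" using B by (cases B; auto)
  have rel: "NU2_rel (dclass ([0,1,2] @ ?Y)) (dclass ([0,0] @ B @ [0,1]))"
    using NU2_rel.rule_b[of 1 B] B B2 by auto
  have q: "qdv ([0,1,2] @ ?Y)"
    using B B2 by (auto simp: qdv_def successively_append_iff successively_Cons hd_append)
  have a: "dclass ([0] @ replicate (Suc g) 0 @ [1] @ A @ replicate (Suc (Suc g)) 1)
      = dclass ([0,0] @ B @ [0,1])"
    if Y: "?Y = replicate (Suc g) 2 @ A @ replicate (Suc g) (-1)" "A = [] \<or> last A \<ge> 0"
    for g A
  proof -
    from Y(1) have "B = replicate (Suc g) 2 @ A @ replicate g (-1)"
      unfolding replicate_Suc_snoc[of g "-1"] by simp
    then show ?thesis using B(3) by auto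
  qed
  have b: "dclass ([0] @ replicate (Suc g) 0 @ B' @ [0] @ replicate (Suc g) 1)
      = dclass ([0,0] @ B @ [0,1])"
    if Y: "?Y = replicate g 2 @ B' @ replicate (Suc g) (-1)" "B' = [] \<or> hd B' \<le> 1" for g B'
  proof -
    from Y(1) have "B = replicate g 2 @ B' @ replicate g (-1)"
      unfolding replicate_Suc_snoc[of g "-1"] by simp
    moreover have "g = 0"
    proof (rule ccontr)
      assume "g \<noteq> 0"
      then have "-1 \<in> set B" using calculation by (cases g) auto
      then show False using B by auto
    qed
    ultimately show ?thesis by simp
  qed
  have "hd ?Y \<le> 2" using B(3) by (cases B) auto
  then show "NU (dclass ([0,1,2] @ B @ [-1])) = dclass ([0,0] @ B @ [0,1])"
    "dclass ([0,1,2] @ B @ [-1]) \<in> NU_dom"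
    using NU_of_NU2_rel[OF rel q _ _ _ a b] by auto
qed

section \<open>Initial objects and single steps between reduced vectors\<close>

lemma NU1_initial_of_last_pos:
  assumes "qdv ([0,0] @ X @ [x])" "x > 0"
  shows "NU1_initial (dclass ([0,0] @ X @ [x]))"
  unfolding NU1_initial_def
proof
  let ?w = "[0,0] @ X @ [x]"
  assume "dclass ?w \<in> (\<lambda>p. ptn_class (NU1 p)) ` D1"
  then obtain q where q: "q \<in> D1" "dclass ?w = ptn_class (NU1 q)" by auto
  obtain p where p: "is_ptn p" "length p < length ?w" "?w = qdv_of (length ?w) p"
    using qdv_obtain_ptn[OF assms(1)] .
  define n where "n = length ?w"
  have wn: "qdv_of n p = ?w" using p(3) by (simp add: n_def)
  have "p = NU1 q"
    using dclass_qdv_of[OF p(1,2)] p(3) q(2) ptn_class_inject[OF p(1) NU1_props(1)[OF q(1)]] by simp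
  \<comment> \<open>Every image under \<open>NU1\<close> has a first part at least as large as its
    number of parts.\<close>
  then have "length p \<le> part p 1" using NU1_props(2,3)[OF q(1)] by simp
  \<comment> \<open>The leading \<open>00\<close> gives the maximal number of parts, and the
    positive last entry makes the first part smaller than that number.\<close>
  moreover have "length p = n - 1" and n: "n \<ge> 3"
    using length_ptn_of_leader[OF p(1), of n 0 "[0] @ X @ [x]"] p(2) wn by (auto simp: n_def)
  moreover have "?w ! (n - 1) = x" by (simp add: n_def nth_append nth_Cons')
  then have "x = int (n - 1) - int (part p 1)"
    using nth_qdv_of[of "n - 1" n p] n wn by simp
  ultimately show False using assms(2) by simp
qed

text \<open>Besides the arrow itself, the relation records the local forms of (c) and of the last
  claim of (e); both then hold along the chain once each of its steps is of this kind.\<close>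

definition nu_step :: "int list \<Rightarrow> int list \<Rightarrow> bool" where
  "nu_step u w \<longleftrightarrow> red u \<and> red w \<and> dclass u \<in> NU_dom \<and> NU (dclass u) = dclass w
     \<and> (NU1_initial (dclass w) \<longleftrightarrow> length w < length u)
     \<and> (length u < length w \<longleftrightarrow> prefix [0,0] u)"

text \<open>The 0 in \<open>A\<close> stays behind the first place, which keeps the target
  reduced.\<close>

lemma nu_step_flat:
  assumes w: "red (map int [0..<m] @ [int m] @ A)" and m: "m \<ge> 1"
    and A: "0 \<in> set A" "hd A \<le> int m" "last A \<ge> int m - 2"
  shows "nu_step (map int [0..<m] @ [int m] @ A) (map int [0..<m] @ A @ [int m - 1])"
    (is "nu_step ?w ?u")
proof -
  have qw: "qdv ?w" and nonneg: "\<forall>x\<in>set ?w. x \<ge> 0" using w by (auto simp: red_def dyck_def)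
  have "A \<noteq> []" using A by auto
  then obtain p where p: "p \<in> D1" "dclass ?w = ptn_class p" "dclass ?u = ptn_class (NU1 p)"
    "qdv ?u"
    using NU1_vector[OF qw refl m] A by auto
  obtain k where k: "m = Suc k" using m by (cases m) auto
  have "red ?u" using p(4) nonneg A m by (auto simp: red_def dyck_def k upt_rec[of 0] simp del: upt_Suc)
  moreover have "\<not> prefix [0,0] ?w" by (cases k) (auto simp: k upt_rec[of 0] upt_rec[of "Suc 0"] simp del: upt_Suc)
  moreover have "\<not> NU1_initial (dclass ?u)" using p by (auto simp: NU1_initial_def)
  ultimately show ?thesis using w NU_of_D1[OF p(1)] p by (simp add: nu_step_def)
qed

lemma nu_step_up:
  assumes w: "red ([0,0] @ A)"
  shows "nu_step ([0,0] @ A) ([0,1] @ map (\<lambda>x. x + 1) A @ [0])"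
proof -
  let ?w = "[0,0] @ A" and ?A = "1 # map (\<lambda>x. x + 1) A"
  have qw: "qdv ?w" and nonneg: "\<forall>x\<in>set ?w. x \<ge> 0" using w by (auto simp: red_def dyck_def)
  \<comment> \<open>A shift within the class turns \<open>00A\<close> into a vector with run
    \<open>0 1\<close>, to which \<open>NU1_vector\<close> applies with
    \<open>m = 1\<close>.\<close>
  have sh: "0 # map (\<lambda>x. x + 1) ?w = map int [0..<1] @ [int 1] @ ?A" by simp
  have q: "qdv (0 # map (\<lambda>x. x + 1) ?w)" using qw
    by (simp add: qdv_def successively_Cons successively_map) (cases A; simp add: successively_map add.commute)
  have "last ?A \<ge> 0" using nonneg by (cases A rule: rev_cases) auto
  then obtain p where p: "p \<in> D1" "dclass (0 # map (\<lambda>x. x + 1) ?w) = ptn_class p"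
    "dclass (map int [0..<1] @ ?A @ [int 1 - 1]) = ptn_class (NU1 p)"
    "qdv (map int [0..<1] @ ?A @ [int 1 - 1])"
    using NU1_vector[OF q sh] by auto
  let ?u = "[0,1] @ map (\<lambda>x. x + 1) A @ [0]"
  have u: "dclass ?u = ptn_class (NU1 p)" "qdv ?u" using p by auto
  have "dclass ?w = ptn_class p" using p dclass_eq_of_shift[OF qw] by simp
  moreover have "red ?u" using u(2) nonneg by (auto simp: red_def dyck_def)
  moreover have "\<not> NU1_initial (dclass ?u)" using u p(1) by (auto simp: NU1_initial_def)
  ultimately show ?thesis using w NU_of_D1[OF p(1)] u by (simp add: nu_step_def)
qed

text \<open>The source is the shift of the left side of rule (a), and its final 0 makes this shift
  reduced; hence the length drops by one. The hypothesis on the vector with leader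
  \<open>00122\<close> supplies nonnegativity and the growth condition for \<open>A\<close>.\<close>

lemma nu_step_down_a:
  assumes "red ([0,0,1,2,2] @ A)" "\<forall>x\<in>set A. x \<le> 2"
  shows "nu_step ([0,1,2,3,3] @ map (\<lambda>x. x + 1) A @ [0]) ([0,0,1] @ A @ [1,1])"
    (is "nu_step ?w ?u")
proof -
  have q: "qdv ([0,0,1,2,2] @ A)" and nonneg: "\<forall>x\<in>set A. x \<ge> 0"
    using assms by (auto simp: red_def dyck_def)
  then have A: "\<forall>x\<in>set A. 0 \<le> x \<and> x \<le> 2" "successively (\<lambda>a b. b \<le> a + 1) A"
    using assms by (auto simp: qdv_def successively_append_iff successively_Cons hd_append)
  have A2: "A = [] \<or> hd A \<le> 2" "A = [] \<or> last A \<ge> 0" using A by (cases A; auto)+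
  have qz: "qdv ([0,1,2,2] @ A @ [-1])" and qu: "qdv ?u"
    using A A2 by (auto simp: qdv_def successively_append_iff successively_Cons hd_append)
  have sh: "0 # map (\<lambda>x. x + 1) ([0,1,2,2] @ A @ [-1]) = ?w" by simp
  have qw: "qdv ?w" using A A2
    by (auto simp: qdv_def successively_append_iff successively_Cons hd_append successively_map hd_map last_map add.commute)
  have "dclass ?w = dclass ([0,1,2,2] @ A @ [-1])" using dclass_eq_of_shift[OF qz] unfolding sh .
  moreover have "red ?w" using qw A by (auto simp: red_def dyck_def)
  moreover have "red ?u" using qu A by (auto simp: red_def dyck_def)
  moreover have "NU1_initial (dclass ?u)"
    using NU1_initial_of_last_pos[of "[1] @ A @ [1]" 1] qu by simp
  ultimately show ?thesis using NU_rule_a[OF A] by (simp add: nu_step_def)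
qed

lemma nu_step_down_b:
  assumes "red ([0,0,1,2] @ B)" "\<forall>x\<in>set B. x \<le> 2" "B = [] \<or> hd B \<le> 1"
  shows "nu_step ([0,1,2,3] @ map (\<lambda>x. x + 1) B @ [0]) ([0,0] @ B @ [0,1])"
    (is "nu_step ?w ?u")
proof -
  have q: "qdv ([0,0,1,2] @ B)" and nonneg: "\<forall>x\<in>set B. x \<ge> 0"
    using assms by (auto simp: red_def dyck_def)
  then have B: "\<forall>x\<in>set B. 0 \<le> x \<and> x \<le> 2" "successively (\<lambda>a b. b \<le> a + 1) B"
    using assms by (auto simp: qdv_def successively_append_iff successively_Cons hd_append)
  have B2: "B = [] \<or> last B \<ge> 0" using B by (cases B; auto)
  have qz: "qdv ([0,1,2] @ B @ [-1])" and qu: "qdv ?u"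
    using B B2 assms(3) by (auto simp: qdv_def successively_append_iff successively_Cons hd_append)
  have sh: "0 # map (\<lambda>x. x + 1) ([0,1,2] @ B @ [-1]) = ?w" by simp
  have qw: "qdv ?w" using B B2 assms(3)
    by (auto simp: qdv_def successively_append_iff successively_Cons hd_append successively_map hd_map last_map add.commute)
  have "dclass ?w = dclass ([0,1,2] @ B @ [-1])" using dclass_eq_of_shift[OF qz] unfolding sh .
  moreover have "red ?w" using qw B by (auto simp: red_def dyck_def)
  moreover have "red ?u" using qu B by (auto simp: red_def dyck_def)
  moreover have "NU1_initial (dclass ?u)"
    using NU1_initial_of_last_pos[of "B @ [0]" 1] qu by simp
  ultimately show ?thesis using NU_rule_b[OF B(1,2) assms(3)] by (simp add: nu_step_def)
qed

subsection \<open>Segments of the chain\<close>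

definition flat :: "int list \<Rightarrow> int list \<Rightarrow> bool" where
  "flat u w \<longleftrightarrow> nu_step u w \<and> length w = length u"

lemma flat_redD: "flat u w \<Longrightarrow> red w"
  by (simp add: flat_def nu_step_def)

lemma flat_pow_redD: "(flat ^^ k) u w \<Longrightarrow> red u \<Longrightarrow> red w"
  by (cases k) (auto dest: flat_redD)

lemma flat_1:
  assumes "red ([0,1] @ W)" "hd W \<le> 1" "0 \<in> set W"
  shows "flat ([0,1] @ W) ([0] @ W @ [0])"
proof -
  have "last W \<in> set W" using assms by (intro last_in_set) auto
  then have "last W \<ge> 0" using assms by (auto simp: red_def dyck_def)
  then show ?thesis using nu_step_flat[of 1 W] assms by (simp add: flat_def)
qed

lemma flat_2:
  assumes "red ([0,1,2] @ W)" "hd W \<le> 2" "0 \<in> set W"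
  shows "flat ([0,1,2] @ W) ([0,1] @ W @ [1])"
proof -
  have "last W \<in> set W" using assms by (intro last_in_set) auto
  then have "last W \<ge> 0" using assms by (auto simp: red_def dyck_def)
  then show ?thesis using nu_step_flat[of 2 W] assms by (simp add: flat_def upt_rec)
qed

text \<open>For runs ending in 1 or 2 the bound on the last entry follows from nonnegativity; for a
  run ending in 3 the last entry has to be positive. The lemmas on blocks carry this as an
  invariant.\<close>

lemma flat_3:
  assumes "red ([0,1,2,3] @ W)" "hd W \<le> 3" "last W \<ge> 1" "0 \<in> set W"
  shows "flat ([0,1,2,3] @ W) ([0,1,2] @ W @ [2])"
  using nu_step_flat[of 3 W] assms by (simp add: flat_def upt_rec)

lemma flat_run:
  assumes "red ([0,1,2] @ replicate k 3 @ W)" "hd W \<le> 3" "last W \<ge> 1" "0 \<in> set W"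
  shows "(flat ^^ k) ([0,1,2] @ replicate k 3 @ W) ([0,1,2] @ W @ replicate k 2)"
  using assms
proof (induction k arbitrary: W)
  case (Suc k)
  have "W \<noteq> []" using Suc.prems by auto
  then have *: "flat ([0,1,2] @ replicate (Suc k) 3 @ W) ([0,1,2] @ replicate k 3 @ (W @ [2]))"
    using flat_3[of "replicate k 3 @ W"] Suc.prems by (auto simp: hd_append)
  have "(flat ^^ k) ([0,1,2] @ replicate k 3 @ (W @ [2])) ([0,1,2] @ (W @ [2]) @ replicate k 2)"
    using Suc.IH[of "W @ [2]"] flat_redD[OF *] Suc.prems \<open>W \<noteq> []\<close> by simp
  from relpowp_Suc_I2[of flat, OF * this] show ?case by simp
qed simp

definition twos_word :: "nat list \<Rightarrow> int list" where
  "twos_word ms = concat (map (\<lambda>k. 1 # replicate k 2) ms)"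

lemma flat_block:
  assumes "red ([0,1,2] @ replicate k 3 @ W)" "hd W \<le> 2" "last W \<ge> 1" "0 \<in> set W"
  shows "(flat ^^ Suc k) ([0,1,2] @ replicate k 3 @ W) ([0,1] @ W @ replicate k 2 @ [1])"
proof -
  have "W \<noteq> []" using assms by auto
  have *: "(flat ^^ k) ([0,1,2] @ replicate k 3 @ W) ([0,1,2] @ W @ replicate k 2)"
    using flat_run assms by simp
  moreover have "flat ([0,1,2] @ W @ replicate k 2) ([0,1] @ (W @ replicate k 2) @ [1])"
    using flat_2[of "W @ replicate k 2"] flat_pow_redD[OF *] assms \<open>W \<noteq> []\<close> by simp
  ultimately show ?thesis using relpowp_Suc_I[of k flat] by simp
qed

text \<open>A raised block \<open>2 3^k\<close> loses its 3s first and its 2 last, so it reappears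
  as \<open>2^k 1\<close>. The appended 1 keeps the last letter positive for the next block.\<close>

lemma flat_blocks:
  assumes "red ([0,1] @ map (\<lambda>x. x + 1) (twos_word ms) @ W)" "hd W \<le> 2" "last W \<ge> 1" "0 \<in> set W"
  shows "(flat ^^ length (twos_word ms)) ([0,1] @ map (\<lambda>x. x + 1) (twos_word ms) @ W)
    ([0,1] @ W @ concat (map (\<lambda>k. replicate k 2 @ [1]) ms))"
  using assms
proof (induction ms arbitrary: W)
  case (Cons k ms)
  let ?R = "map (\<lambda>x. x + 1) (twos_word ms) @ W"
  have "W \<noteq> []" using Cons.prems by auto
  have split: "[0,1] @ map (\<lambda>x. x + 1) (twos_word (k # ms)) @ W = [0,1,2] @ replicate k 3 @ ?R"
    by (simp add: twos_word_def)
  have "hd ?R \<le> 2" using Cons.prems by (cases ms) (auto simp: twos_word_def)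
  then have *: "(flat ^^ Suc k) ([0,1,2] @ replicate k 3 @ ?R) ([0,1] @ ?R @ replicate k 2 @ [1])"
    using flat_block[of k ?R] Cons.prems \<open>W \<noteq> []\<close> unfolding split by simp
  let ?W = "W @ replicate k 2 @ [1]"
  have red0: "red ([0,1,2] @ replicate k 3 @ ?R)" using Cons.prems(1) unfolding split .
  have "(flat ^^ length (twos_word ms)) ([0,1] @ map (\<lambda>x. x + 1) (twos_word ms) @ ?W)
      ([0,1] @ ?W @ concat (map (\<lambda>k. replicate k 2 @ [1]) ms))"
    by (rule Cons.IH)
      (use flat_pow_redD[OF * red0] Cons.prems \<open>W \<noteq> []\<close> in \<open>simp_all add: append_assoc\<close>)
  then have "(flat ^^ (Suc k + length (twos_word ms))) ([0,1,2] @ replicate k 3 @ ?R)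
      ([0,1] @ ?W @ concat (map (\<lambda>k. replicate k 2 @ [1]) ms))"
    using * unfolding relpowp_add by (auto simp: append_assoc)
  moreover have "length (twos_word (k # ms)) = Suc k + length (twos_word ms)"
    by (simp add: twos_word_def)
  ultimately show ?case unfolding split by simp
qed (simp add: twos_word_def)

text \<open>A 1 in front regroups the output of \<open>flat_blocks\<close> into blocks
  \<open>1 2^k\<close>, with one 1 left over at the end.\<close>

lemma twos_word_shift: "[1] @ concat (map (\<lambda>k. replicate k 2 @ [1]) ms) = twos_word ms @ [1]"
  by (induction ms) (auto simp: twos_word_def)

text \<open>A raised letter 1 or 2 triggers \<open>flat_1\<close> or \<open>flat_2\<close>, which
  appends 0 or 1; so \<open>D\<close> is restored behind \<open>W\<close>.\<close>

lemma flat_binary: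
  assumes "red ([0,1] @ map (\<lambda>x. x + 1) D @ W)" "set D \<subseteq> {0,1}" "hd W \<le> 2" "0 \<in> set W"
  shows "(flat ^^ length D) ([0,1] @ map (\<lambda>x. x + 1) D @ W) ([0,1] @ W @ D)"
  using assms
proof (induction D arbitrary: W)
  case (Cons d D)
  let ?R = "map (\<lambda>x. x + 1) D @ W"
  have "W \<noteq> []" using Cons.prems by auto
  have hd: "hd ?R \<le> 2" using Cons.prems by (cases D) auto
  have "flat ([0,1] @ (d + 1) # ?R) ([0,1] @ ?R @ [d])"
  proof (cases "d = 0")
    case True
    then show ?thesis using flat_1[of "1 # ?R"] Cons.prems by simp
  next
    case False
    then have "d = 1" using Cons.prems by auto
    then show ?thesis using flat_2[of ?R] hd Cons.prems by simp
  qed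
  then have *: "flat ([0,1] @ map (\<lambda>x. x + 1) (d # D) @ W) ([0,1] @ map (\<lambda>x. x + 1) D @ (W @ [d]))"
    by simp
  have "(flat ^^ length D) ([0,1] @ map (\<lambda>x. x + 1) D @ (W @ [d])) ([0,1] @ (W @ [d]) @ D)"
    by (rule Cons.IH) (use flat_redD[OF *] Cons.prems \<open>W \<noteq> []\<close> in auto)
  from relpowp_Suc_I2[of flat, OF * this] show ?case by simp
qed simp

lemma red_twos_word:
  assumes "set D \<subseteq> {0,1}"
  shows "red ([0,0] @ twos_word ms @ D)"
proof -
  let ?P = "\<lambda>a b :: int. b \<le> a + 1"
  have twos: "successively ?P (a # replicate k 2 @ l)"
    if "a \<ge> 1" "\<And>b. b \<ge> 0 \<Longrightarrow> successively ?P (b # l)" for a k l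
    using that(1) by (induction k arbitrary: a) (use that(2) in auto)
  have "successively ?P (a # D)" if "a \<ge> 0" for a
    using that assms by (induction D arbitrary: a) auto
  then have "successively ?P (a # twos_word ms @ D)" if "a \<ge> 0" for a
    using that
  proof (induction ms arbitrary: a)
    case (Cons k ms)
    then show ?case using twos[of 1 "twos_word ms @ D" k] by (simp add: twos_word_def)
  qed (simp add: twos_word_def)
  then have "qdv ([0,0] @ twos_word ms @ D)" by (simp add: qdv_def)
  then show ?thesis using assms by (auto simp: red_def dyck_def twos_word_def)
qed

text \<open>The vectors beginning with \<open>00\<close> in the chain are \<open>mvec (ms, D)\<close>, with \<open>ms\<close> the list of the
  remaining multiplicities and \<open>D\<close> a binary word.\<close>

fun mvec :: "nat list \<times> int list \<Rightarrow> int list" where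
  "mvec (ms, D) = [0,0] @ twos_word ms @ D"

fun mstep :: "nat list \<times> int list \<Rightarrow> nat list \<times> int list" where
  "mstep ([], D) = ([], D @ [0])"
| "mstep (0 # ms, D) = (ms, [1] @ D @ [0])"
| "mstep (Suc 0 # ms, D) = (ms, D @ [0,1])"
| "mstep (Suc (Suc k) # ms, D) = (k # ms, D @ [1,1])"

text \<open>The states whose segment is closed by a step of \<open>NU2\<close>, back at the original
  length.\<close>

definition descending :: "nat list \<times> int list \<Rightarrow> bool" where
  "descending M \<longleftrightarrow> fst M \<noteq> [] \<and> hd (fst M) > 0"

lemma mstep_binary: "set (snd M) \<subseteq> {0,1} \<Longrightarrow> set (snd (mstep M)) \<subseteq> {0,1}"
  by (cases M rule: mstep.cases) auto

text \<open>The object \<open>x\<close> comes from \<open>nu_step_up\<close>. In the ascending case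
  the flat steps process the raised letters in order, and a closing \<open>flat_1\<close> removes
  the 1 of the run and so exposes \<open>00\<close>.\<close>

lemma segment:
  assumes "set (snd M) \<subseteq> {0,1}"
  obtains x where "nu_step (mvec M) x" "length x = Suc (length (mvec M))"
    "if descending M then nu_step x (mvec (mstep M)) \<and> length (mvec (mstep M)) = length (mvec M)
     else (flat ^^ (length (mvec M) - 1)) x (mvec (mstep M))"
proof -
  obtain ms D where M: "M = (ms, D)" by (cases M)
  let ?x = "[0,1] @ map (\<lambda>x. x + 1) (twos_word ms @ D) @ [0]"
  have D: "set D \<subseteq> {0,1}" using assms M by simp
  have up: "nu_step (mvec M) ?x" using nu_step_up[OF red_twos_word[OF D, of ms]] by (simp add: M)
  then have redx: "red ?x" by (simp add: nu_step_def)
  have "if descending M then nu_step ?x (mvec (mstep M)) \<and> length (mvec (mstep M)) = length (mvec M)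
     else (flat ^^ (length (mvec M) - 1)) ?x (mvec (mstep M))"
  proof (cases M rule: mstep.cases)
    case (1 D')
    then have [simp]: "ms = []" "D' = D" using M by auto
    have a: "(flat ^^ length D) ?x ([0,1] @ [0] @ D)"
      using flat_binary[of D "[0]"] redx D by (simp add: twos_word_def)
    then have "flat ([0,1] @ [0] @ D) ([0] @ ([0] @ D) @ [0])"
      using flat_1[of "[0] @ D"] flat_pow_redD[OF a redx] by simp
    from relpowp_Suc_I[OF a this] show ?thesis
      by (simp add: 1 M twos_word_def descending_def)
  next
    case (2 ms' D')
    then have [simp]: "ms = 0 # ms'" "D' = D" using M by auto
    let ?R = "map (\<lambda>x. x + 1) (twos_word ms' @ D) @ [0]"
    have x: "?x = [0,1,2] @ ?R" by (simp add: twos_word_def)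
    have "hd ?R \<le> 2" using D by (cases ms'; cases D) (auto simp: twos_word_def)
    \<comment> \<open>Removing the 2 of the empty block appends a 1 behind the final 0; this
      supplies the positive last letter that \<open>flat_blocks\<close> asks for.\<close>
    then have "flat ?x ([0,1] @ ?R @ [1])" using flat_2[of ?R] redx unfolding x by simp
    then have a: "flat ?x ([0,1] @ map (\<lambda>x. x + 1) (twos_word ms') @ (map (\<lambda>x. x + 1) D @ [0,1]))"
      by simp
    have "hd (map (\<lambda>x. x + 1) D @ [0,1]) \<le> 2" using D by (cases D) auto
    then have b: "(flat ^^ length (twos_word ms'))
      ([0,1] @ map (\<lambda>x. x + 1) (twos_word ms') @ (map (\<lambda>x. x + 1) D @ [0,1]))
      ([0,1] @ (map (\<lambda>x. x + 1) D @ [0,1]) @ concat (map (\<lambda>k. replicate k 2 @ [1]) ms'))"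
      using flat_blocks[of ms' "map (\<lambda>x. x + 1) D @ [0,1]"] flat_redD[OF a] by simp
    \<comment> \<open>The 1 appended first becomes the head of the regrouped blocks.\<close>
    moreover have "(map (\<lambda>x. x + 1) D @ [0,1]) @ concat (map (\<lambda>k. replicate k 2 @ [1]) ms')
        = map (\<lambda>x. x + 1) D @ ([0] @ twos_word ms' @ [1])"
      using twos_word_shift[of ms'] by simp
    ultimately have b': "(flat ^^ length (twos_word ms'))
      ([0,1] @ map (\<lambda>x. x + 1) (twos_word ms') @ (map (\<lambda>x. x + 1) D @ [0,1]))
      ([0,1] @ map (\<lambda>x. x + 1) D @ ([0] @ twos_word ms' @ [1]))" by simp
    have c: "(flat ^^ length D) ([0,1] @ map (\<lambda>x. x + 1) D @ ([0] @ twos_word ms' @ [1]))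
      ([0,1] @ ([0] @ twos_word ms' @ [1]) @ D)"
      using flat_binary[of D "[0] @ twos_word ms' @ [1]"] D flat_pow_redD[OF b' flat_redD[OF a]]
      by simp
    have d: "flat ([0,1] @ ([0] @ twos_word ms' @ [1]) @ D) ([0] @ (([0] @ twos_word ms' @ [1]) @ D) @ [0])"
      using flat_1[of "([0] @ twos_word ms' @ [1]) @ D"]
        flat_pow_redD[OF c flat_pow_redD[OF b' flat_redD[OF a]]] by simp
    \<comment> \<open>One step for the empty block, one for each remaining letter and one for the
      closing \<open>flat_1\<close>: together the length of \<open>mvec M\<close> minus 1.\<close>
    have "(flat ^^ (Suc (length (twos_word ms')) + Suc (length D))) ?x
      ([0] @ (([0] @ twos_word ms' @ [1]) @ D) @ [0])"
      unfolding relpowp_add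
      using relpowp_Suc_I2[of flat, OF a b'] relpowp_Suc_I[OF c d] by blast
    then show ?thesis by (simp add: 2 M twos_word_def descending_def)
  next
    case (3 ms' D')
    then have [simp]: "ms = Suc 0 # ms'" "D' = D" using M by auto
    have "twos_word ms' @ D = [] \<or> hd (twos_word ms' @ D) \<le> 1"
      using D by (cases ms'; cases D) (auto simp: twos_word_def)
    moreover have "\<forall>x\<in>set (twos_word ms' @ D). x \<le> 2" using D by (auto simp: twos_word_def)
    moreover have "red ([0,0,1,2] @ twos_word ms' @ D)"
      using red_twos_word[OF D, of ms] by (simp add: twos_word_def)
    ultimately show ?thesis using nu_step_down_b[of "twos_word ms' @ D"]
      by (simp add: 3 descending_def twos_word_def)
  next
    case (4 k ms' D')
    then have [simp]: "ms = Suc (Suc k) # ms'" "D' = D" using M by auto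
    let ?A = "replicate k 2 @ twos_word ms' @ D"
    have "\<forall>x\<in>set ?A. x \<le> 2" using D by (auto simp: twos_word_def)
    moreover have "red ([0,0,1,2,2] @ ?A)"
      using red_twos_word[OF D, of ms] by (simp add: twos_word_def)
    ultimately show ?thesis using nu_step_down_a[of ?A]
      by (simp add: 4 descending_def twos_word_def)
  qed
  with that[OF up] show ?thesis by (simp add: M)
qed

lemma stair_word_Suc: "stair_word L (Suc m) = stair_word L m @ replicate (L + m) (L + m + 1)"
  by (simp add: stair_word_def)

section \<open>Invariants and termination of \<open>mstep\<close>\<close>

lemma length_mvec: "length (mvec M) \<ge> 2"
  by (cases M) simp

lemma length_mvec_mstep:
  "length (mvec (mstep M)) = (if descending M then length (mvec M) else Suc (length (mvec M)))"
  by (cases M rule: mstep.cases) (auto simp: descending_def twos_word_def)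

lemma area_mvec_mstep:
  "area (mvec (mstep M)) = area (mvec M) - (if descending M then 2 else 0)"
  by (cases M rule: mstep.cases) (auto simp: descending_def twos_word_def)

lemma two_in_mvec_iff:
  "set (snd M) \<subseteq> {0,1} \<Longrightarrow> 2 \<in> set (mvec M) \<longleftrightarrow> (\<exists>k\<in>set (fst M). k > 0)"
  by (cases M) (auto simp: twos_word_def)

lemma set_mvec: "set (snd M) \<subseteq> {0,1} \<Longrightarrow> set (mvec M) \<subseteq> {0,1,2}"
  by (cases M) (auto simp: twos_word_def)

text \<open>The last letter tells which kind of segment has just ended; this later singles out the
  vectors satisfying \<open>form_00X1\<close>.\<close>

lemma mvec_mstep_last:
  "\<exists>X. mvec (mstep M) = [0,0] @ X @ [if descending M then 1 else 0]"
proof (cases M rule: mstep.cases)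
  case (1 D)
  then show ?thesis by (simp add: descending_def twos_word_def)
next
  case (2 ms D)
  then show ?thesis by (intro exI[of _ "twos_word ms @ [1] @ D"]) (simp add: descending_def)
next
  case (3 ms D)
  then show ?thesis by (intro exI[of _ "twos_word ms @ D @ [0]"]) (simp add: descending_def)
next
  case (4 k ms D)
  then show ?thesis
    by (intro exI[of _ "twos_word (k # ms) @ D @ [1]"]) (simp add: descending_def)
qed

lemma fst_mstep_zero: "\<forall>k\<in>set (fst M). k = 0 \<Longrightarrow> \<forall>k\<in>set (fst (mstep M)). k = 0"
  by (cases M rule: mstep.cases) auto

text \<open>The number of blocks is part of the measure because discarding an empty block leaves the
  sum unchanged.\<close>

lemma mstep_measure:
  "fst M \<noteq> [] \<Longrightarrow>
    sum_list (fst (mstep M)) + length (fst (mstep M)) < sum_list (fst M) + length (fst M)"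
  by (cases M rule: mstep.cases) auto

lemma eventually_Nil: "\<exists>t. fst ((mstep ^^ t) M) = []"
proof (induction "sum_list (fst M) + length (fst M)" arbitrary: M rule: less_induct)
  case less
  show ?case
  proof (cases "fst M = []")
    case True
    then show ?thesis by (intro exI[of _ 0]) simp
  next
    case False
    then obtain t where "fst ((mstep ^^ t) (mstep M)) = []"
      using less[OF mstep_measure] by blast
    then show ?thesis by (intro exI[of _ "Suc t"]) (simp add: funpow_swap1)
  qed
qed

lemma not_descending_of_zero: "\<forall>k\<in>set (fst M). k = 0 \<Longrightarrow> \<not> descending M"
  by (cases "fst M") (auto simp: descending_def)

section \<open>The chain from an arbitrary state with binary tail\<close>

locale nu_chain =
  fixes M0 :: "nat list \<times> int list"
  assumes binary: "set (snd M0) \<subseteq> {0,1}"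
begin

abbreviation "obj i \<equiv> (NU ^^ i) (dclass (mvec M0))"

definition "M t = (mstep ^^ t) M0"

definition "L t = length (mvec (M t))"

text \<open>\<open>pos t\<close> is the index in the chain of the \<open>t\<close>-th object whose reduced vector begins with \<open>00\<close>.\<close>

primrec pos :: "nat \<Rightarrow> nat" where
  "pos 0 = 0"
| "pos (Suc t) = pos t + (if descending (M t) then 2 else L t)"

definition "f i = reduced (obj i)"

definition at :: "nat \<Rightarrow> int list \<Rightarrow> bool" where
  "at i u \<longleftrightarrow> obj i = dclass u \<and> red u"

lemma M_0 [simp]: "M 0 = M0" and M_Suc [simp]: "M (Suc t) = mstep (M t)"
  by (simp_all add: M_def)

lemma binary_M: "set (snd (M t)) \<subseteq> {0,1}"
proof (induction t)
  case 0
  show ?case using binary by simp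
next
  case (Suc t)
  then show ?case unfolding M_Suc by (rule mstep_binary)
qed

lemma L_ge_2: "L t \<ge> 2"
  using length_mvec by (simp add: L_def)

lemma L_Suc: "L (Suc t) = (if descending (M t) then L t else Suc (L t))"
  by (simp add: L_def length_mvec_mstep)

lemma at_f: "at i u \<Longrightarrow> f i = u"
  by (simp add: at_def f_def red_min_delta)

lemma at_step: "at i u \<Longrightarrow> nu_step u w \<Longrightarrow> at (Suc i) w"
  by (simp add: at_def nu_step_def)

lemma at_flat_pow:
  assumes "(flat ^^ k) u w" "at i u"
  shows "at (i + k) w \<and> (\<forall>j<k. nu_step (f (i + j)) (f (Suc (i + j))))
    \<and> (\<forall>j\<le>k. length (f (i + j)) = length u)"
  using assms
proof (induction k arbitrary: w)
  case 0
  then show ?case by (simp add: at_f)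
next
  case (Suc k)
  then obtain x where x: "(flat ^^ k) u x" "flat x w" by auto
  note IH = Suc.IH[OF x(1) Suc.prems(2)]
  then have ax: "at (i + k) x" and lx: "length (f (i + k)) = length u" by auto
  have xw: "nu_step x w" "length w = length x" using x(2) by (simp_all add: flat_def)
  have "at (Suc (i + k)) w" using at_step[OF ax xw(1)] .
  moreover have "nu_step (f (i + k)) (f (Suc (i + k)))" "length (f (Suc (i + k))) = length u"
    using xw lx at_f[OF ax] at_f[OF calculation] by auto
  ultimately show ?case using IH by (auto simp: less_Suc_eq le_Suc_eq)
qed

lemma segment_at:
  assumes "at (pos t) (mvec (M t))"
  shows "at (pos (Suc t)) (mvec (M (Suc t)))
    \<and> (\<forall>i. pos t \<le> i \<and> i < pos (Suc t) \<longrightarrow> nu_step (f i) (f (Suc i)))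
    \<and> (\<forall>i. pos t < i \<and> i < pos (Suc t) \<longrightarrow> length (f i) = Suc (L t))"
proof -
  obtain x where x: "nu_step (mvec (M t)) x" "length x = Suc (L t)"
    and r: "if descending (M t) then nu_step x (mvec (M (Suc t))) \<and> length (mvec (M (Suc t))) = L t
      else (flat ^^ (L t - 1)) x (mvec (M (Suc t)))"
    unfolding L_def M_Suc by (rule segment[OF binary_M])
  have ax: "at (Suc (pos t)) x" using at_step[OF assms x(1)] .
  have s0: "nu_step (f (pos t)) (f (Suc (pos t)))" using x(1) at_f[OF assms] at_f[OF ax] by simp
  show ?thesis
  proof (cases "descending (M t)")
    case True
    have a2: "at (pos (Suc t)) (mvec (M (Suc t)))" using at_step[OF ax] r True by simp
    then have "nu_step (f (Suc (pos t))) (f (Suc (Suc (pos t))))"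
      using r True at_f[OF ax] at_f[OF a2] by simp
    moreover have "i = pos t \<or> i = Suc (pos t)" if "pos t \<le> i" "i < pos (Suc t)" for i
      using that True by auto
    ultimately show ?thesis using a2 s0 x(2) at_f[OF ax] by (metis nat_less_le)
  next
    case False
    then have fl: "(flat ^^ (L t - 1)) x (mvec (M (Suc t)))" using r by simp
    note F = at_flat_pow[OF fl ax]
    \<comment> \<open>One step up and \<open>L t - 1\<close> flat steps make up the
      \<open>L t\<close> steps of an ascending segment.\<close>
    have e: "Suc (pos t) + (L t - 1) = pos (Suc t)" using False L_ge_2[of t] by simp
    have seg: "nu_step (f i) (f (Suc i)) \<and> (i > pos t \<longrightarrow> length (f i) = Suc (L t))"
      if "pos t \<le> i" "i < pos (Suc t)" for i
    proof (cases "i = pos t")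
      case False
      then have "i = Suc (pos t) + (i - Suc (pos t))" "i - Suc (pos t) < L t - 1"
        using that e by auto
      then show ?thesis using F x(2) by (metis less_imp_le_nat)
    qed (use s0 in simp)
    have "at (pos (Suc t)) (mvec (M (Suc t)))" using F unfolding e by (rule conjunct1)
    then show ?thesis by (intro conjI allI impI) (simp_all add: seg del: pos.simps M_Suc)
  qed
qed

lemma at_pos: "at (pos t) (mvec (M t))"
proof (induction t)
  case 0
  have "red (mvec M0)" using red_twos_word binary by (cases M0) simp
  then show ?case by (simp add: at_def)
next
  case (Suc t)
  then show ?case using segment_at by blast
qed

lemma f_pos: "f (pos t) = mvec (M t)"
  using at_f[OF at_pos] .

lemma pos_less_Suc: "Suc (pos t) < pos (Suc t)"
  using L_ge_2[of t] by auto

declare pos.simps(2) [simp del]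

lemma strict_mono_pos: "strict_mono pos"
  unfolding strict_mono_Suc_iff using pos_less_Suc Suc_lessD by blast

lemma pos_cover: "\<exists>t. pos t \<le> i \<and> i < pos (Suc t)"
proof (induction i)
  case 0
  then show ?case using pos_less_Suc[of 0] by (intro exI[of _ 0]) simp
next
  case (Suc i)
  then obtain t where t: "pos t \<le> i" "i < pos (Suc t)" by auto
  show ?case
  proof (cases "Suc i < pos (Suc t)")
    case False
    then have "Suc i = pos (Suc t)" using t by simp
    then show ?thesis using pos_less_Suc[of "Suc t"] by (intro exI[of _ "Suc t"]) simp
  qed (use t in \<open>auto intro: exI[of _ t]\<close>)
qed

lemma nu_step_f: "nu_step (f i) (f (Suc i))"
  using pos_cover[of i] segment_at[OF at_pos] by blast

lemma at_all: "at i (f i)"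
proof (induction i)
  case 0
  then show ?case using at_pos[of 0] f_pos[of 0] by simp
next
  case (Suc i)
  then show ?case using at_step nu_step_f by blast
qed

lemma obj_eq: "obj i = dclass (f i)" and red_f: "red (f i)"
  using at_all[of i] by (simp_all add: at_def)

lemma min_delta_obj: "min_delta (obj i) = length (f i)" and reduced_obj: "reduced (obj i) = f i"
  using red_min_delta[OF red_f[of i]] by (simp_all add: obj_eq)

lemma NU_dom_obj: "obj i \<in> NU_dom"
  using nu_step_f[of i] by (simp add: obj_eq nu_step_def)

lemma NU_chain_eq: "NU_chain (dclass (mvec M0)) = range obj"
  using NU_dom_obj by (auto simp: NU_chain_def NU_defined_def)

lemma initial_iff_length: "NU1_initial (obj (Suc i)) \<longleftrightarrow> length (f (Suc i)) < length (f i)"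
  using nu_step_f[of i] by (simp only: obj_eq nu_step_def)

lemma prefix_iff_length: "prefix [0,0] (f i) \<longleftrightarrow> length (f i) < length (f (Suc i))"
  using nu_step_f[of i] by (simp only: nu_step_def)

lemma length_f_pos: "length (f (pos t)) = L t"
  by (simp add: f_pos L_def)

lemma length_f_interior: "pos t < i \<Longrightarrow> i < pos (Suc t) \<Longrightarrow> length (f i) = Suc (L t)"
  using segment_at[OF at_pos] by blast

lemma length_f_Suc_pos: "length (f (Suc (pos t))) = Suc (L t)"
  using length_f_interior[of t "Suc (pos t)"] pos_less_Suc[of t] by simp

lemma length_f_before_pos: "length (f (pos (Suc t) - 1)) = Suc (L t)"
  using length_f_interior[of t "pos (Suc t) - 1"] pos_less_Suc[of t] by simp

text \<open>After the start of a segment the length stays at \<open>L t + 1\<close>, so it can drop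
  only on arrival at \<open>pos (Suc t)\<close>, where it is \<open>L t\<close> or
  \<open>L t + 1\<close> according to \<open>descending\<close>.\<close>

lemma initial_iff:
  assumes "i > 0"
  shows "NU1_initial (obj i) \<longleftrightarrow> (\<exists>t. i = pos (Suc t) \<and> descending (M t))"
proof -
  obtain j where j: "i = Suc j" using assms by (cases i) auto
  obtain t where t: "pos t \<le> j" "j < pos (Suc t)" using pos_cover by blast
  have inj: "pos s = pos s' \<Longrightarrow> s = s'" for s s' using strict_mono_eq[OF strict_mono_pos] by blast
  show ?thesis
  proof (cases "i = pos (Suc t)")
    case True
    have "j = pos (Suc t) - 1" using True j by simp
    then have "length (f j) = Suc (L t)" using length_f_before_pos[of t] by simp
    moreover have "length (f i) = L (Suc t)" unfolding True by (rule length_f_pos)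
    ultimately have "NU1_initial (obj i) \<longleftrightarrow> descending (M t)"
      unfolding j initial_iff_length by (auto simp: L_Suc)
    then show ?thesis using True inj by blast
  next
    case False
    then have i: "pos t < i" "i < pos (Suc t)" using t j by auto
    then have "length (f i) = Suc (L t)" by (rule length_f_interior)
    moreover have "length (f j) \<le> Suc (L t)"
      using length_f_interior[of t j] length_f_pos[of t] t by (cases "j = pos t") auto
    ultimately have "\<not> NU1_initial (obj i)" unfolding j initial_iff_length by simp
    moreover have "i \<noteq> pos (Suc s)" for s
      using i strict_mono_less[OF strict_mono_pos] by (metis not_less_eq less_Suc_eq)
    ultimately show ?thesis by blast
  qed
qed

text \<open>Strictly inside a segment the length is \<open>L t + 1\<close> and the next object is
  not longer, so \<open>prefix_iff_length\<close> excludes a leading \<open>00\<close>.\<close>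

lemma prefix_imp_pos:
  assumes "prefix [0,0] (f i)"
  shows "\<exists>t. i = pos t"
proof -
  obtain t where t: "pos t \<le> i" "i < pos (Suc t)" using pos_cover by blast
  show ?thesis
  proof (cases "i = pos t")
    case False
    then have l: "length (f i) = Suc (L t)" using t by (intro length_f_interior) auto
    have "length (f (Suc i)) \<le> Suc (L t)"
    proof (cases "Suc i = pos (Suc t)")
      case True
      then show ?thesis using length_f_pos[of "Suc t"] by (simp add: L_Suc split: if_splits)
    next
      case False
      then show ?thesis using t length_f_interior[of t "Suc i"] by simp
    qed
    then show ?thesis using assms l by (simp add: prefix_iff_length)
  qed auto
qed

section \<open>Profiles\<close>

lemma profile_eq: "profile (dclass (mvec M0)) a b = map (\<lambda>i. length (f i)) [a..<b]"
  by (simp add: profile_def min_delta_obj)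

lemma profile_split:
  "a \<le> b \<Longrightarrow> b \<le> c \<Longrightarrow>
    profile (dclass (mvec M0)) a c = profile (dclass (mvec M0)) a b @ profile (dclass (mvec M0)) b c"
  unfolding profile_def map_append[symmetric] by (metis le_Suc_ex upt_add_eq_append)

text \<open>The window omits the initial \<open>00\<close>-vector and includes the final one.
  Without a descent the final length is already \<open>L t + 1\<close>, which completes the
  \<open>L t - 1\<close> interior values to a full block of the stair word.\<close>

lemma profile_segment:
  "profile (dclass (mvec M0)) (Suc (pos t)) (Suc (pos (Suc t)))
    = (if descending (M t) then [Suc (L t), L t] else replicate (L t) (Suc (L t)))"
proof -
  have "profile (dclass (mvec M0)) (Suc (pos t)) (Suc (pos (Suc t)))
      = map (\<lambda>i. length (f i)) [Suc (pos t)..<pos (Suc t)] @ [L (Suc t)]"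
    unfolding profile_eq using pos_less_Suc[of t] length_f_pos[of "Suc t"]
    by simp
  also have "map (\<lambda>i. length (f i)) [Suc (pos t)..<pos (Suc t)]
      = replicate (pos (Suc t) - Suc (pos t)) (Suc (L t))"
    by (rule map_upt_eqI) (simp_all add: length_f_interior[of t])
  also have "replicate (pos (Suc t) - Suc (pos t)) (Suc (L t)) @ [L (Suc t)]
      = (if descending (M t) then [Suc (L t), L t] else replicate (L t) (Suc (L t)))"
  proof (cases "descending (M t)")
    case False
    then have "pos (Suc t) - Suc (pos t) = L t - 1" by (simp add: pos.simps)
    moreover have "L t = Suc (L t - 1)" using L_ge_2[of t] by simp
    ultimately show ?thesis using False by (metis L_Suc replicate_append_same replicate_Suc)
  qed (simp add: L_Suc pos.simps)
  finally show ?thesis .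
qed

lemma profile_pos_Suc:
  assumes "s \<le> t"
  shows "profile (dclass (mvec M0)) (pos s) (Suc (pos (Suc t)))
    = profile (dclass (mvec M0)) (pos s) (Suc (pos t))
      @ (if descending (M t) then [Suc (L t), L t] else replicate (L t) (Suc (L t)))"
proof -
  have "pos s \<le> pos t" using strict_mono_less_eq[OF strict_mono_pos] assms by blast
  then show ?thesis using profile_split[of "pos s" "Suc (pos t)" "Suc (pos (Suc t))"]
      profile_segment[of t] pos_less_Suc[of t] by simp
qed

lemma profile_pos_same: "profile (dclass (mvec M0)) (pos s) (Suc (pos s)) = [L s]"
  by (simp add: profile_eq length_f_pos)

text \<open>Each segment without descent adds one block to the stair word. The unchanged area is
  carried along in the same induction for (g).\<close>

lemma profile_flat:
  assumes "\<And>u. s \<le> u \<Longrightarrow> u < s + e \<Longrightarrow> \<not> descending (M u)"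
  shows "L (s + e) = L s + e \<and> area (mvec (M (s + e))) = area (mvec (M s))
    \<and> profile (dclass (mvec M0)) (pos s) (Suc (pos (s + e))) = stair_word (L s) e"
  using assms
proof (induction e)
  case 0
  then show ?case by (simp add: profile_pos_same stair_word_def)
next
  case (Suc e)
  then have "\<not> descending (M (s + e))" by simp
  moreover have "L (s + e) = L s + e \<and> area (mvec (M (s + e))) = area (mvec (M s))
    \<and> profile (dclass (mvec M0)) (pos s) (Suc (pos (s + e))) = stair_word (L s) e"
    using Suc by simp
  ultimately show ?case
    using profile_pos_Suc[of s "s + e"]
    by (simp add: L_Suc area_mvec_mstep stair_word_Suc)
qed

lemma profile_descending:
  assumes "\<And>u. u < e \<Longrightarrow> descending (M (s + u))"
  shows "L (s + e) = L s \<and> profile (dclass (mvec M0)) (pos s) (Suc (pos (s + e)))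
    = L s # concat (replicate e [L s + 1, L s])"
  using assms
proof (induction e)
  case 0
  then show ?case by (simp add: profile_pos_same)
next
  case (Suc e)
  then have "descending (M (s + e))" by simp
  moreover have "L (s + e) = L s \<and> profile (dclass (mvec M0)) (pos s) (Suc (pos (s + e)))
    = L s # concat (replicate e [L s + 1, L s])"
    using Suc by simp
  ultimately show ?case
    using profile_pos_Suc[of s "s + e"]
    by (simp add: L_Suc replicate_append_same[symmetric])
qed

section \<open>Unbounded growth and absence of repetitions\<close>

lemma zero_stays:
  assumes "\<forall>k\<in>set (fst (M t)). k = 0" "t \<le> u"
  shows "\<forall>k\<in>set (fst (M u)). k = 0"
  using assms(2) by (induction rule: dec_induct) (use assms(1) fst_mstep_zero in auto)

lemma L_unbounded: "\<exists>t. L t > B"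
proof -
  obtain t where "fst (M t) = []" using eventually_Nil[of M0] unfolding M_def by blast
  then have "\<not> descending (M u)" if "t \<le> u" for u
    using zero_stays[of t u] that not_descending_of_zero by simp
  then have "L (t + Suc B) = L t + Suc B" using profile_flat[of t "Suc B"] by blast
  then show ?thesis by (intro exI[of _ "t + Suc B"]) simp
qed

text \<open>A repetition would make the chain eventually periodic and its lengths bounded by those
  before \<open>b\<close>, contrary to \<open>L_unbounded\<close>. In (b) this turns positions
  described by their classes into definite indices.\<close>

lemma obj_inject:
  assumes "obj a = obj b"
  shows "a = b"
proof -
  have *: False if ab: "a < b" "obj a = obj b" for a b
  proof -
    have "obj (j + a) = obj (j + b)" for j using ab(2) by (simp only: funpow_add comp_apply)
    then have "f (j + a) = f (j + b)" for j by (simp add: f_def)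
    then have per: "f i = f (i - (b - a))" if "i \<ge> b" for i
      using that ab(1) by (metis Nat.diff_diff_right le_add_diff_inverse2 less_imp_le_nat Nat.add_diff_assoc2)
    have "finite ((\<lambda>i. length (f i)) ` {..<b})" by simp
    then obtain B where B: "\<And>i. i < b \<Longrightarrow> length (f i) \<le> B"
      unfolding finite_nat_set_iff_bounded_le by auto
    have "length (f i) \<le> B" for i
    proof (induction i rule: less_induct)
      case (less i)
      show ?case
      proof (cases "i < b")
        case False
        then have "f i = f (i - (b - a))" "i - (b - a) < i" using per ab(1) by auto
        then show ?thesis using less by simp
      qed (rule B)
    qed
    then show False using L_unbounded[of B] length_f_pos by (metis not_less)
  qed
  show ?thesis using *[of a b] *[of b a] assms by (metis nat_neq_iff)
qed

section \<open>Enumeration of the initial objects\<close>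

lemma initial_pos_eq: "initial_pos (mvec M0) = {pos (Suc t) | t. descending (M t)}"
proof -
  have "pos (Suc t) > 0" for t using pos_less_Suc[of t] by simp
  then show ?thesis using NU_dom_obj initial_iff unfolding initial_pos_def NU_defined_def by blast
qed

lemma finite_initial_pos: "finite (initial_pos (mvec M0))"
proof -
  obtain t where "fst (M t) = []" using eventually_Nil[of M0] unfolding M_def by blast
  then have "\<not> descending (M u)" if "t \<le> u" for u
    using zero_stays[of t u] that not_descending_of_zero by simp
  then have "initial_pos (mvec M0) \<subseteq> (\<lambda>u. pos (Suc u)) ` {..<t}"
    unfolding initial_pos_eq using not_le by blast
  then show ?thesis by (rule finite_subset) simp
qed

lemma S_pos_in:
  assumes "0 < j" "j \<le> S_num (mvec M0)"
  shows "S_pos (mvec M0) j \<in> initial_pos (mvec M0)"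
  using assms nth_mem[of "j - 1" "sorted_list_of_set (initial_pos (mvec M0))"] finite_initial_pos
  by (simp add: S_pos_def S_num_def nth_Cons')

lemma S_pos_surj:
  assumes "y \<in> initial_pos (mvec M0)"
  obtains j where "0 < j" "j \<le> S_num (mvec M0)" "S_pos (mvec M0) j = y"
proof -
  have "y \<in> set (sorted_list_of_set (initial_pos (mvec M0)))" using assms finite_initial_pos by simp
  then obtain k where "k < length (sorted_list_of_set (initial_pos (mvec M0)))"
    "sorted_list_of_set (initial_pos (mvec M0)) ! k = y" by (metis in_set_conv_nth)
  then show ?thesis using that[of "Suc k"] by (simp add: S_pos_def S_num_def)
qed

lemma S_pos_0: "S_pos (mvec M0) 0 = 0"
  by (simp add: S_pos_def)

lemma S_pos_mono:
  assumes "j < k" "k \<le> S_num (mvec M0)"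
  shows "S_pos (mvec M0) j < S_pos (mvec M0) k"
proof -
  have "0 \<notin> initial_pos (mvec M0)" by (simp add: initial_pos_def)
  then have "sorted_wrt (<) (0 # sorted_list_of_set (initial_pos (mvec M0)))"
    using finite_initial_pos by (auto intro: gr0I)
  from sorted_wrt_nth_less[OF this assms(1)] show ?thesis
    using assms(2) by (simp add: S_pos_def S_num_def)
qed

lemma S_pos_between:
  assumes "j < S_num (mvec M0)" "y \<in> initial_pos (mvec M0)" "S_pos (mvec M0) j < y"
  shows "S_pos (mvec M0) (Suc j) \<le> y"
proof -
  obtain k where k: "0 < k" "k \<le> S_num (mvec M0)" "S_pos (mvec M0) k = y"
    using S_pos_surj[OF assms(2)] .
  have "j < k"
  proof (rule ccontr)
    assume "\<not> j < k"
    then have "k = j \<or> k < j" by auto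
    then show False using S_pos_mono[of k j] k assms by auto
  qed
  then show ?thesis using S_pos_mono[of "Suc j" k] k by (cases "Suc j = k") auto
qed

lemma S_vec_eq: "S_vec (mvec M0) j = f (S_pos (mvec M0) j)"
  using f_pos[of 0] by (simp add: S_vec_def S_pos_0 reduced_obj)

lemma S_pos_pos:
  assumes "j \<le> S_num (mvec M0)"
  obtains s where "S_pos (mvec M0) j = pos s"
proof (cases "j = 0")
  case True
  then show ?thesis using that[of 0] by (simp add: S_pos_0)
next
  case False
  then show ?thesis using S_pos_in[of j] assms that by (auto simp: initial_pos_eq)
qed

text \<open>From one S-vector to the next there are \<open>e\<close> segments without descent and
  then one descending segment; an earlier descent would put another initial position in between. The
  start is included, since position 0 is \<open>pos 0\<close>.\<close>

lemma S_consecutive: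
  assumes j: "j < S_num (mvec M0)"
  obtains s e where "S_pos (mvec M0) j = pos s" "S_pos (mvec M0) (Suc j) = pos (Suc (s + e))"
    "descending (M (s + e))" "\<forall>u. s \<le> u \<and> u < s + e \<longrightarrow> \<not> descending (M u)"
proof -
  obtain s where s: "S_pos (mvec M0) j = pos s" using S_pos_pos j by (metis less_imp_le_nat)
  obtain t where t: "S_pos (mvec M0) (Suc j) = pos (Suc t)" "descending (M t)"
    using S_pos_in[of "Suc j"] j by (auto simp: initial_pos_eq)
  have "pos s < pos (Suc t)" using S_pos_mono[of j "Suc j"] j s t by simp
  then have "s \<le> t" using strict_mono_less[OF strict_mono_pos] by (metis less_Suc_eq_le)
  moreover have "\<not> descending (M u)" if "s \<le> u" "u < t" for u
  proof
    assume "descending (M u)"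
    then have "pos (Suc u) \<in> initial_pos (mvec M0)" by (auto simp: initial_pos_eq)
    moreover have "pos s < pos (Suc u)" "pos (Suc u) < pos (Suc t)"
      using that strict_mono_less[OF strict_mono_pos] by (metis le_imp_less_Suc, metis Suc_mono)
    ultimately show False using S_pos_between[OF j, of "pos (Suc u)"] s t by simp
  qed
  ultimately show ?thesis using that[of s "t - s"] s t by simp
qed

lemma S_last:
  assumes "y \<in> initial_pos (mvec M0)" "\<And>z. z \<in> initial_pos (mvec M0) \<Longrightarrow> z \<le> y"
  shows "S_pos (mvec M0) (S_num (mvec M0)) = y"
proof -
  obtain k where k: "0 < k" "k \<le> S_num (mvec M0)" "S_pos (mvec M0) k = y"
    using S_pos_surj[OF assms(1)] .
  have "S_pos (mvec M0) (S_num (mvec M0)) \<le> y" using S_pos_in[of "S_num (mvec M0)"] k assms(2) by simp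
  then show ?thesis using S_pos_mono[of k "S_num (mvec M0)"] k by (cases "k = S_num (mvec M0)") auto
qed

end

subsection \<open>The vectors of the theorem\<close>

lemma twos_eq: "twos n a b = twos_word (map n [a..<b])"
  by (simp add: twos_def twos_word_def comp_def)

lemma even_count_Suc: "even_count n (Suc i) = even_count n i + (if even (n i) then 1 else 0)"
proof -
  have "{k. k < Suc i \<and> even (n k)} = {k. k < i \<and> even (n k)} \<union> (if even (n i) then {i} else {})"
    by (auto simp: less_Suc_eq)
  then show ?thesis by (simp add: even_count_def)
qed

lemma even_count_0 [simp]: "even_count n 0 = 0"
  by (simp add: even_count_def)

lemma tail_blocks_Suc:
  "tail_blocks n (Suc i) = tail_blocks n i @ replicate (2 * (n i div 2)) 1 @ [0] @ replicate (n i mod 2) 1"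
  by (simp add: tail_blocks_def)

lemma set_tail_blocks: "set (tail_blocks n i) \<subseteq> {0,1}"
  by (auto simp: tail_blocks_def)

lemma replicate_Suc_Suc: "replicate k x @ [x, x] = replicate (Suc (Suc k)) x"
  by (simp add: replicate_app_Cons_same)

section \<open>The classes \<open>TI\<close> and binary words; initiality of the start\<close>

definition B_gen :: "nat list \<Rightarrow> nat \<Rightarrow> int list" where
  "B_gen p R = concat (map (\<lambda>k. 0 # replicate (count_list p k) 1) [1..<Suc R])"

text \<open>\<open>B_gen\<close> replaces the largest part by a free bound \<open>R\<close>, so that
  words ending in 0 can occur in the induction. Read from left to right, a 0 raises \<open>R\<close>
  and a 1 adds a part \<open>R\<close>; after a final 1 the largest part is \<open>R\<close>, and
  \<open>B_gen\<close> agrees with \<open>B_word\<close>.\<close>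

lemma B_gen_binary_word:
  assumes "set w \<subseteq> {0,1}"
  shows "\<exists>R p. is_ptn p \<and> R \<ge> 1 \<and> (\<forall>x\<in>set p. x \<le> R) \<and> B_gen p R = 0 # w
    \<and> (w \<noteq> [] \<and> last w = 1 \<longrightarrow> p \<noteq> [] \<and> hd p = R)"
  using assms
proof (induction w rule: rev_induct)
  case Nil
  show ?case by (intro exI[of _ 1] exI[of _ "[]"]) (simp add: is_ptn_def B_gen_def)
next
  case (snoc a w)
  then obtain R p where Rp: "is_ptn p" "R \<ge> 1" "\<forall>x\<in>set p. x \<le> R" "B_gen p R = 0 # w"
    by auto
  show ?case
  proof (cases "a = 0")
    case True
    have "Suc R \<notin> set p" using Rp(3) by auto
    then have "B_gen p (Suc R) = B_gen p R @ [0]" by (simp add: B_gen_def count_list_0_iff)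
    then show ?thesis using Rp True
      by (intro exI[of _ "Suc R"] exI[of _ p]) (auto simp: le_Suc_eq)
  next
    case False
    then have a: "a = 1" using snoc.prems by auto
    have "B_gen (R # p) R = B_gen p R @ [1]"
    proof -
      have "map (\<lambda>k. 0 # replicate (count_list (R # p) k) (1::int)) [1..<R]
          = map (\<lambda>k. 0 # replicate (count_list p k) 1) [1..<R]" by (rule map_cong) auto
      moreover have "B_gen q R = concat (map (\<lambda>k. 0 # replicate (count_list q k) 1) [1..<R])
          @ 0 # replicate (count_list q R) 1" for q
        using Rp(2) by (simp add: B_gen_def)
      ultimately show ?thesis by (simp only:) (simp add: replicate_append_same)
    qed
    then show ?thesis using Rp a
      by (intro exI[of _ R] exI[of _ "R # p"]) (auto simp: is_ptn_def)
  qed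
qed

lemma TI_of_binary_word:
  assumes "set w \<subseteq> {0,1}" "w \<noteq> []" "last w = 1"
  shows "\<exists>p. is_ptn p \<and> dclass ([0,0] @ w) = TI p"
proof -
  obtain R p where "is_ptn p" "B_gen p R = 0 # w" "p \<noteq> []" "hd p = R"
    using B_gen_binary_word[OF assms(1)] assms(2,3) by blast
  moreover have "part p 1 = hd p" using calculation by (cases p) (auto simp: part_def)
  ultimately have "B_word p = 0 # w" by (simp add: B_word_def B_gen_def)
  then show ?thesis using \<open>is_ptn p\<close> by (auto simp: TI_def)
qed

text \<open>A positive last letter gives initiality; for empty \<open>C\<close> this letter is the 2
  that ends the last block. If \<open>C\<close> ends in 0, a predecessor under \<open>NU1\<close> is
  exhibited.\<close>

lemma NU1_initial_start:
  assumes "set C \<subseteq> {0,1}" and last: "ms \<noteq> []" "last ms > 0"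
  shows "NU1_initial (dclass (mvec (ms, C))) \<longleftrightarrow> C = [] \<or> last C = 1"
proof -
  have red: "red (mvec (ms, C))" using red_twos_word[OF assms(1)] by simp
  have q: "qdv (mvec (ms, C))" using red by (simp add: red_def dyck_def)
  consider "C = []" | C' where "C = C' @ [1]" | C' where "C = C' @ [0]"
    using assms(1) by (cases C rule: rev_cases) auto
  then show ?thesis
  proof cases
    case 1
    obtain ms' k where ms: "ms = ms' @ [Suc k]"
      using last by (cases ms rule: rev_cases) (auto simp: gr0_conv_Suc)
    then have "mvec (ms, C) = [0,0] @ (twos_word ms' @ 1 # replicate k 2) @ [2]"
      using 1 by (simp add: twos_word_def replicate_append_same)
    then show ?thesis using NU1_initial_of_last_pos[of "twos_word ms' @ 1 # replicate k 2" 2] q 1 by simp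
  next
    case (2 C')
    then have "mvec (ms, C) = [0,0] @ (twos_word ms @ C') @ [1]" by simp
    then show ?thesis using NU1_initial_of_last_pos[of "twos_word ms @ C'" 1] q 2 by simp
  next
    case (3 C')
    let ?X = "twos_word ms @ C'"
    have v: "mvec (ms, C) = [0] @ (0 # ?X) @ [0]" using 3 by simp
    \<comment> \<open>The predecessor: drop the final 0 and put a 1 back after the first 0.\<close>
    have "red ([0,1] @ (0 # ?X))"
      using red unfolding v
      by (auto simp: red_def dyck_def qdv_def successively_Cons successively_append_iff hd_append
          split: if_splits)
    then have "flat ([0,1] @ (0 # ?X)) ([0] @ (0 # ?X) @ [0])" by (rule flat_1) auto
    then have "\<not> NU1_initial (dclass (mvec (ms, C)))" unfolding v flat_def nu_step_def by auto
    then show ?thesis using 3 by simp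
  qed
qed

lemma length_stair_word: "length (stair_word L m) \<ge> (if L \<ge> 1 then Suc m else 1)"
  by (induction m) (auto simp: stair_word_def)

section \<open>The states reached from the given vector\<close>

locale theorem_data =
  fixes r :: nat and n :: "nat \<Rightarrow> nat" and C :: "int list"
  assumes n_last: "n r > 0" and C_binary: "set C \<subseteq> {0,1}"
begin

definition "start = (map n [0..<Suc r], C)"

text \<open>The state after the blocks before \<open>i\<close> have been used up and
  \<open>c\<close> pairs of 2s have left block \<open>i\<close>.\<close>

definition "st i c = ((n i - 2 * c) # map n [Suc i..<Suc r],
  replicate (even_count n i) 1 @ C @ tail_blocks n i @ replicate (2 * c) 1)"

sublocale nu_chain start
  by unfold_locales (simp add: start_def C_binary)

lemma mvec_st: "mvec (st i c) = mid_vec r n C i c"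
  by (simp add: st_def mid_vec_def twos_eq twos_word_def)

lemma mvec_st_0: "i \<le> r \<Longrightarrow> mvec (st i 0) = v_vec r n C i"
  by (simp add: st_def v_vec_def twos_eq twos_word_def upt_conv_Cons del: upt_Suc)

lemma start_eq: "start = st 0 0"
  by (simp add: start_def st_def tail_blocks_def upt_conv_Cons del: upt_Suc)

lemma M_start: "M 0 = st 0 0"
  by (rule trans[OF M_0 start_eq])

lemma descending_st: "descending (st i c) \<longleftrightarrow> 2 * c < n i"
  by (auto simp: descending_def st_def)

lemma mstep_st_down:
  assumes "2 * Suc c \<le> n i"
  shows "mstep (st i c) = st i (Suc c)"
proof -
  have "n i - 2 * c = Suc (Suc (n i - 2 * c - 2))" using assms by simp
  then obtain k where k: "n i - 2 * c = Suc (Suc k)" by blast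
  then have "k = n i - 2 * Suc c" by simp
  then show ?thesis using k by (simp add: st_def replicate_Suc_Suc)
qed

text \<open>What remains of block \<open>i\<close> is \<open>n i mod 2\<close>. Remainder 0 puts a 1
  in front, which is the increment of \<open>even_count\<close>, and closes the tail block with 0;
  remainder 1 closes it with 01.\<close>

lemma mstep_st_next:
  assumes "i < r"
  shows "mstep (st i (n i div 2)) = st (Suc i) 0"
proof (cases "even (n i)")
  case True
  then show ?thesis using assms
    by (simp add: st_def even_count_Suc tail_blocks_Suc upt_conv_Cons even_iff_mod_2_eq_zero del: upt_Suc)
next
  case False
  then have "n i - 2 * (n i div 2) = Suc 0" "n i mod 2 = 1" by presburger+
  then show ?thesis using assms False
    by (simp add: st_def even_count_Suc tail_blocks_Suc upt_conv_Cons del: upt_Suc)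
qed

text \<open>For even \<open>n r\<close> the last vector is \<open>st r (n r div 2)\<close>, whose list of multiplicities is \<open>[0]\<close>
  and not \<open>[]\<close>; the index \<open>(n r - 1) div 2\<close> treats both parities uniformly.\<close>

lemma mvec_mstep_st_final:
  "mvec (mstep (st r ((n r - 1) div 2))) = v_vec r n C (Suc r)"
  "\<forall>k\<in>set (fst (mstep (st r ((n r - 1) div 2)))). k = 0"
proof -
  have "n r = Suc (2 * (n r div 2)) \<or> n r = Suc (Suc (2 * ((n r - 1) div 2)))"
    using n_last by presburger
  then consider c where "n r = Suc (2 * c)" | c where "n r = Suc (Suc (2 * c))" by blast
  then have "mvec (mstep (st r ((n r - 1) div 2))) = v_vec r n C (Suc r)
    \<and> (\<forall>k\<in>set (fst (mstep (st r ((n r - 1) div 2)))). k = 0)"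
  proof cases
    case (1 c)
    then show ?thesis by (simp add: st_def v_vec_def even_count_Suc twos_word_def)
  next
    case (2 c)
    then have c: "(n r - 1) div 2 = c" "n r div 2 = Suc c" "n r mod 2 = 0" by auto
    have "mstep (st r c) = st r (Suc c)" using 2 by (intro mstep_st_down) simp
    then show ?thesis
      using 2 by (simp only: c mvec_st)
        (simp add: st_def mid_vec_def v_vec_def even_count_Suc twos_def twos_word_def c)
  qed
  then show "mvec (mstep (st r ((n r - 1) div 2))) = v_vec r n C (Suc r)"
    "\<forall>k\<in>set (fst (mstep (st r ((n r - 1) div 2)))). k = 0" by blast+
qed

text \<open>The number of segments before \<open>v_vec r n C i\<close>: block \<open>k\<close> takes
  \<open>n k div 2\<close> segments for its pairs and one for its remainder.\<close>

definition "idx i = (\<Sum>k<i. n k div 2 + 1)"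

text \<open>For even \<open>n r\<close>, unlike for earlier blocks, no segment is spent on the empty
  remainder.\<close>

definition "idx_last = idx r + (n r - 1) div 2 + 1"

lemma M_idx_add: "M (idx i) = st i 0 \<Longrightarrow> 2 * c \<le> n i \<Longrightarrow> M (idx i + c) = st i c"
  by (induction c) (auto simp: mstep_st_down)

lemma M_idx: "i \<le> r \<Longrightarrow> M (idx i) = st i 0"
proof (induction i)
  case 0
  then show ?case by (simp add: idx_def start_eq[symmetric])
next
  case (Suc i)
  then have "M (idx i + n i div 2) = st i (n i div 2)" by (intro M_idx_add) auto
  then show ?case using Suc.prems by (simp add: idx_def mstep_st_next)
qed

lemma M_st: "i \<le> r \<Longrightarrow> 2 * c \<le> n i \<Longrightarrow> M (idx i + c) = st i c"
  using M_idx_add M_idx by blast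

lemma M_idx_last: "mvec (M idx_last) = v_vec r n C (Suc r)" "\<forall>k\<in>set (fst (M idx_last)). k = 0"
  using M_st[of r "(n r - 1) div 2"] mvec_mstep_st_final by (simp_all add: idx_last_def)

lemma fst_mstep_single: "k \<le> 1 \<Longrightarrow> fst (mstep ([k], D)) = []"
  by (cases k) auto

lemma M_cases:
  "(\<exists>i c. i \<le> r \<and> 2 * c \<le> n i \<and> M t = st i c) \<or> (\<forall>k\<in>set (fst (M t)). k = 0)"
proof (induction t)
  case 0
  show ?case by (intro disjI1 exI[of _ 0] conjI M_start) auto
next
  case (Suc t)
  then show ?case
  proof
    assume "\<exists>i c. i \<le> r \<and> 2 * c \<le> n i \<and> M t = st i c"
    then obtain i c where ic: "i \<le> r" "2 * c \<le> n i" "M t = st i c" by auto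
    show ?thesis
    proof (cases "2 * Suc c \<le> n i")
      case True
      then show ?thesis using ic mstep_st_down[OF True]
        by (intro disjI1 exI[of _ i] exI[of _ "Suc c"]) simp
    next
      case False
      then have c: "c = n i div 2" using ic(2) by auto
      show ?thesis
      proof (cases "i < r")
        case True
        then show ?thesis using ic c mstep_st_next[OF True]
          by (intro disjI1 exI[of _ "Suc i"] exI[of _ 0]) simp
      next
        case False
        \<comment> \<open>The last block has at most one 2 left, so the next state has no
          blocks.\<close>
        then have "M t = ([n r - 2 * c], snd (M t))" using ic by (simp add: st_def)
        moreover have "n r - 2 * c \<le> 1" using False ic c by auto
        ultimately have "fst (mstep (M t)) = []" using fst_mstep_single by metis
        then show ?thesis by simp
      qed
    qed
  next
    assume "\<forall>k\<in>set (fst (M t)). k = 0"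
    then show ?thesis using fst_mstep_zero by auto
  qed
qed

text \<open>A descent removes either a pair of 2s, which leads to a \<open>mid_vec\<close>, or the
  single remaining 2 of a block with odd multiplicity, which leads to the next
  \<open>v_vec\<close>.\<close>

lemma descending_vectors:
  "{mvec (M (Suc t)) | t. descending (M t)}
    = {v_vec r n C i | i. 0 < i \<and> i \<le> r + 1 \<and> odd (n (i - 1))}
      \<union> {mid_vec r n C i c | i c. i \<le> r \<and> 0 < 2 * c \<and> 2 * c \<le> n i}" (is "?A = ?B \<union> ?C")
proof (intro equalityI subsetI)
  fix w assume "w \<in> ?A"
  then obtain t where t: "w = mvec (M (Suc t))" "descending (M t)" by auto
  then obtain i c where ic: "i \<le> r" "2 * c \<le> n i" "M t = st i c"
    using M_cases[of t] not_descending_of_zero by blast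
  then have c: "2 * c < n i" using t(2) descending_st by simp
  show "w \<in> ?B \<union> ?C"
  proof (cases "2 * Suc c \<le> n i")
    case True
    then have "w = mid_vec r n C i (Suc c)" using t ic mstep_st_down mvec_st by simp
    then show ?thesis using True ic(1)
      by (intro UnI2 CollectI exI[of _ i] exI[of _ "Suc c"]) simp
  next
    case False
    then have n: "n i = Suc (2 * c)" using c by simp
    have "w = v_vec r n C (Suc i)"
    proof (cases "i < r")
      case True
      then show ?thesis using t ic n mstep_st_next[OF True] mvec_st_0[of "Suc i"] by simp
    next
      case False
      then show ?thesis using t ic n mvec_mstep_st_final by simp
    qed
    then show ?thesis using ic(1) n by (intro UnI1 CollectI exI[of _ "Suc i"]) auto
  qed
next
  fix w assume "w \<in> ?B \<union> ?C"
  then show "w \<in> ?A"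
  proof
    assume "w \<in> ?B"
    then obtain i where i: "w = v_vec r n C (Suc i)" "i \<le> r" "odd (n i)"
      by (auto simp: gr0_conv_Suc)
    then obtain c where c: "n i = Suc (2 * c)" by (auto elim: oddE)
    have M: "M (idx i + c) = st i c" using M_st i c by simp
    then have "descending (M (idx i + c))" using descending_st c by simp
    moreover have "mvec (M (Suc (idx i + c))) = w"
    proof (cases "i < r")
      case True
      then show ?thesis using i M c mstep_st_next[OF True] mvec_st_0[of "Suc i"] by simp
    next
      case False
      then show ?thesis using i M c mvec_mstep_st_final by simp
    qed
    ultimately show ?thesis by blast
  next
    assume "w \<in> ?C"
    then obtain i c' where i': "w = mid_vec r n C i c'" "i \<le> r" "0 < c'" "2 * c' \<le> n i"
      by auto
    then obtain c where "c' = Suc c" by (cases c') auto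
    then have i: "w = mid_vec r n C i (Suc c)" "i \<le> r" "2 * Suc c \<le> n i" using i' by auto
    have "M (idx i + c) = st i c" using M_st i by simp
    then have "descending (M (idx i + c))" "mvec (M (Suc (idx i + c))) = w"
      using descending_st i mstep_st_down mvec_st by auto
    then show ?thesis by blast
  qed
qed

lemma mvec_start:
  "mvec start = [0,0] @ concat (map (\<lambda>k. 1 # replicate (n k) 2) [0..<Suc r]) @ C"
  by (simp add: start_def twos_word_def comp_def del: upt_Suc)

lemma NU1_initial_mvec_start: "NU1_initial (dclass (mvec start)) \<longleftrightarrow> C = [] \<or> last C = 1"
proof -
  have "last (map n [0..<Suc r]) > 0" using n_last by simp
  then show ?thesis unfolding start_def using NU1_initial_start[OF C_binary] by simp
qed

section \<open>Positions of the vectors \<open>v_vec r n C i\<close> and the profiles between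
  them\<close>

definition "ix i = (if i \<le> r then idx i else idx_last)"

lemma f_ix: "i \<le> Suc r \<Longrightarrow> f (pos (ix i)) = v_vec r n C i"
  using M_idx[of i] mvec_st_0[of i] M_idx_last(1)
  by (cases "i = Suc r") (auto simp: f_pos ix_def)

lemma obj_ix: "i \<le> Suc r \<Longrightarrow> obj (pos (ix i)) = dclass (v_vec r n C i)"
  using obj_eq f_ix by simp

lemma L_ix: "i \<le> Suc r \<Longrightarrow> L (ix i) = length (v_vec r n C i)"
  using length_f_pos f_ix by metis

lemma not_descending_after:
  assumes "idx_last \<le> t"
  shows "\<not> descending (M t)"
  using zero_stays[OF M_idx_last(2) assms] by (rule not_descending_of_zero)

lemma ix_descending:
  assumes "i \<le> r" "u < (n i + 1) div 2"
  shows "descending (M (ix i + u))"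
  using assms M_st[of i u] descending_st[of i u] by (simp add: ix_def)

text \<open>Block \<open>i\<close> causes \<open>(n i + 1) div 2\<close> descents; an ascending
  segment for the emptied block follows exactly when \<open>n i\<close> is even and
  \<open>i < r\<close>.\<close>

lemma ix_Suc:
  assumes "i \<le> r"
  shows "ix (Suc i) = ix i + (n i + 1) div 2 + (if even (n i) \<and> i < r then 1 else 0)"
proof (cases "i = r")
  case True
  have "(n r - 1) div 2 + 1 = (n r + 1) div 2" using n_last by presburger
  then show ?thesis using True by (simp add: ix_def idx_last_def)
next
  case False
  then have "ix (Suc i) = ix i + (n i div 2 + 1)" using assms by (simp add: ix_def idx_def)
  moreover have "n i div 2 + 1 = (n i + 1) div 2 + (if even (n i) then 1 else 0)" by auto
  ultimately show ?thesis using assms False by simp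
qed

lemma ix_not_descending:
  assumes "i < r" "even (n i)"
  shows "\<not> descending (M (ix i + (n i + 1) div 2))"
  using assms M_st[of i "n i div 2"] descending_st[of i "n i div 2"] by (simp add: ix_def)

lemma profile_ix:
  assumes "i \<le> r"
  shows "profile (dclass (mvec start)) (pos (ix i)) (Suc (pos (ix (Suc i))))
    = L (ix i) # concat (replicate ((n i + 1) div 2) [L (ix i) + 1, L (ix i)])
      @ (if even (n i) \<and> i < r then replicate (L (ix i)) (L (ix i) + 1) else [])"
proof -
  let ?e = "(n i + 1) div 2"
  note P = profile_descending[of ?e "ix i", OF ix_descending[OF assms]]
  show ?thesis
  proof (cases "even (n i) \<and> i < r")
    case True
    then have "\<not> descending (M (ix i + ?e))" by (intro ix_not_descending) auto
    moreover have "ix (Suc i) = Suc (ix i + ?e)" using ix_Suc[OF assms] True by simp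
    ultimately show ?thesis using True P profile_pos_Suc[of "ix i" "ix i + ?e"] by simp
  next
    case False
    then have "ix (Suc i) = ix i + ?e" using ix_Suc[OF assms] by auto
    then show ?thesis using P False by auto
  qed
qed

lemma profile_final:
  "stair_prefix (length (v_vec r n C (r + 1))) (profile (dclass (v_vec r n C (r + 1))) 0 m)"
proof -
  let ?t = "ix (Suc r)" and ?P = "profile (dclass (mvec start))"
  have t: "?t = idx_last" by (simp add: ix_def)
  note P = profile_flat[of ?t m, OF not_descending_after]
  have L: "L ?t = length (v_vec r n C (r + 1))" using L_ix by simp
  have stair: "?P (pos ?t) (Suc (pos (?t + m))) = stair_word (L ?t) m" using P t by simp
  \<comment> \<open>Every block of the stair word is nonempty, so \<open>m\<close> blocks cover the
    first \<open>m\<close> objects.\<close>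
  have "length (stair_word (L ?t) m) \<ge> Suc m"
    using length_stair_word[where L = "L ?t" and m = m] L_ge_2[of ?t] by simp
  then have le: "pos ?t + m \<le> Suc (pos (?t + m))" unfolding stair[symmetric] by (simp add: profile_def del: upt_Suc)
  \<comment> \<open>The chain from \<open>v_vec r n C (r + 1)\<close> is a tail of the chain from
    the start, with indices shifted by \<open>pos ?t\<close>.\<close>
  have "profile (dclass (v_vec r n C (r + 1))) 0 m = ?P (pos ?t) (pos ?t + m)"
  proof -
    have "dclass (v_vec r n C (r + 1)) = obj (pos ?t)" using obj_ix by simp
    then have "(NU ^^ i) (dclass (v_vec r n C (r + 1))) = obj (i + pos ?t)" for i
      by (simp add: funpow_add)
    then show ?thesis unfolding profile_def by (intro nth_equalityI) (simp_all add: add.commute)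
  qed
  then have "prefix (profile (dclass (v_vec r n C (r + 1))) 0 m) (stair_word (L ?t) m)"
    using profile_split[OF _ le] stair by (metis le_add1 prefixI)
  then show ?thesis unfolding stair_prefix_def L by blast
qed

lemma last_initial_pos:
  "pos (ix (Suc r)) \<in> initial_pos (mvec start)"
  "z \<in> initial_pos (mvec start) \<Longrightarrow> z \<le> pos (ix (Suc r))"
proof -
  have "descending (M (idx r + (n r - 1) div 2))"
    using M_st[of r "(n r - 1) div 2"] descending_st n_last by auto
  then show "pos (ix (Suc r)) \<in> initial_pos (mvec start)"
    by (auto simp: initial_pos_eq ix_def idx_last_def)
  assume "z \<in> initial_pos (mvec start)"
  then obtain t where t: "z = pos (Suc t)" "descending (M t)" by (auto simp: initial_pos_eq)
  then have "t < idx_last" using not_descending_after not_le by blast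
  then show "z \<le> pos (ix (Suc r))"
    using strict_mono_less_eq[OF strict_mono_pos] t by (simp add: ix_def)
qed

lemma S_pos_last: "S_pos (mvec start) (S_num (mvec start)) = pos (ix (Suc r))"
  using S_last last_initial_pos by blast

text \<open>Since \<open>n r > 0\<close>, the word after \<open>00\<close> ends in 1: in a pair of
  1s for even \<open>n r\<close>, in 01 for odd \<open>n r\<close>.\<close>

lemma v_vec_last_TI: "\<exists>p. is_ptn p \<and> dclass (v_vec r n C (r + 1)) = TI p"
proof -
  let ?w = "replicate (even_count n (Suc r)) 1 @ C @ tail_blocks n r
             @ replicate (2 * (n r div 2)) 1 @ concat (replicate (n r mod 2) [0,1])"
  have "set ?w \<subseteq> {0,1}" using C_binary set_tail_blocks[of n r] by auto
  moreover have "?w \<noteq> [] \<and> last ?w = 1"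
  proof (cases "even (n r)")
    case True
    then have "replicate (2 * (n r div 2)) (1::int) = replicate (n r - 1) 1 @ [1]"
      using n_last replicate_append_same[of "n r - 1" "1::int"] by (cases "n r") auto
    then show ?thesis using True by simp
  next
    case False
    then show ?thesis by (simp add: odd_iff_mod_2_eq_one)
  qed
  ultimately show ?thesis using TI_of_binary_word[of ?w] by (simp add: v_vec_def)
qed

section \<open>The assertions (a) to (g)\<close>

lemma part_a:
  "v_vec r n C 0 = mvec start
    \<and> (\<forall>i\<le>r+1. dclass (v_vec r n C i) \<in> NU_chain (dclass (mvec start)))
    \<and> (\<exists>p. is_ptn p \<and> dclass (v_vec r n C (r+1)) = TI p)"
proof (intro conjI allI impI v_vec_last_TI)
  show "v_vec r n C 0 = mvec start" using mvec_st_0[of 0] start_eq by simp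
  fix i assume "i \<le> r + 1"
  then have "dclass (v_vec r n C i) = obj (pos (ix i))" using obj_ix by simp
  then show "dclass (v_vec r n C i) \<in> NU_chain (dclass (mvec start))" unfolding NU_chain_eq by blast
qed

lemma part_b:
  "(\<forall>i\<le>r+1. length (v_vec r n C i) = min_delta (dclass (v_vec r n C i)))
    \<and> (\<forall>i\<le>r. \<forall>a b. obj a = dclass (v_vec r n C i) \<and> obj b = dclass (v_vec r n C (i+1)) \<longrightarrow>
        (let L = length (v_vec r n C i) in
           profile (dclass (mvec start)) a (Suc b)
             = L # concat (replicate ((n i + 1) div 2) [L + 1, L])
               @ (if even (n i) \<and> i < r then replicate L (L + 1) else [])))
    \<and> (\<forall>m. stair_prefix (length (v_vec r n C (r+1)))
              (profile (dclass (v_vec r n C (r+1))) 0 m))"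
proof (intro conjI allI impI profile_final)
  fix i assume "i \<le> r + 1"
  then show "length (v_vec r n C i) = min_delta (dclass (v_vec r n C i))"
    using min_delta_obj[of "pos (ix i)"] obj_ix[of i] f_ix[of i] by simp
next
  fix i a b assume i: "i \<le> r"
    and "obj a = dclass (v_vec r n C i) \<and> obj b = dclass (v_vec r n C (i + 1))"
  then have "obj a = obj (pos (ix i))" "obj b = obj (pos (ix (Suc i)))"
    using obj_ix[of i] obj_ix[of "Suc i"] by simp_all
  \<comment> \<open>\<open>obj_inject\<close> leaves no other positions for these classes.\<close>
  then have "a = pos (ix i)" "b = pos (ix (Suc i))" by (auto dest: obj_inject)
  then show "let L = length (v_vec r n C i) in
           profile (dclass (mvec start)) a (Suc b)
             = L # concat (replicate ((n i + 1) div 2) [L + 1, L])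
               @ (if even (n i) \<and> i < r then replicate L (L + 1) else [])"
    using profile_ix[OF i] L_ix[of i] i unfolding Let_def by simp
qed

lemma part_c:
  "\<forall>i>0. NU1_initial (obj i) \<longleftrightarrow> min_delta (obj (i - 1)) > min_delta (obj i)"
proof (intro allI impI)
  fix i :: nat assume "i > 0"
  then obtain j where "i = Suc j" by (cases i) auto
  then show "NU1_initial (obj i) \<longleftrightarrow> min_delta (obj (i - 1)) > min_delta (obj i)"
    unfolding min_delta_obj by (simp only: initial_iff_length diff_Suc_1)
qed

text \<open>The start is an S-vector without having to be initial, hence the restriction on the
  left; all other initial positions are enumerated by \<open>S_pos\<close>.\<close>

lemma S_vec_initial_eq:
  "{S_vec (mvec start) j | j. j \<le> S_num (mvec start) \<and> NU1_initial (dclass (S_vec (mvec start) j))}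
    = {f i | i. NU1_initial (obj i)}" (is "?A = ?B")
proof (intro equalityI subsetI)
  fix w assume "w \<in> ?A"
  then show "w \<in> ?B" unfolding S_vec_eq obj_eq[symmetric] by blast
next
  fix w assume "w \<in> ?B"
  then obtain i where i: "w = f i" "NU1_initial (obj i)" by auto
  have "\<exists>j\<le>S_num (mvec start). S_pos (mvec start) j = i"
  proof (cases "i = 0")
    case False
    then have "i \<in> initial_pos (mvec start)"
      using i(2) NU_dom_obj by (auto simp: initial_pos_def NU_defined_def)
    then show ?thesis using S_pos_surj by metis
  qed (auto simp: S_pos_0 intro: exI[of _ 0])
  then show "w \<in> ?A" using i unfolding S_vec_eq obj_eq[symmetric] by blast
qed

lemma initial_vectors:
  "{f i | i. NU1_initial (obj i)}
    = {w. w = mvec start \<and> (C = [] \<or> last C = 1)} \<union> {mvec (M (Suc t)) | t. descending (M t)}"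
  (is "?A = ?B \<union> ?D")
proof (intro equalityI subsetI)
  have f0: "f 0 = mvec start" using f_pos[of 0] by simp
  {
    fix w assume "w \<in> ?A"
    then obtain i where i: "w = f i" "NU1_initial (obj i)" by auto
    show "w \<in> ?B \<union> ?D"
    proof (cases "i = 0")
      case True
      then show ?thesis using i f0 NU1_initial_mvec_start by simp
    next
      case False
      then obtain t where "i = pos (Suc t)" "descending (M t)" using i initial_iff by blast
      then show ?thesis using i(1) f_pos[of "Suc t"] by blast
    qed
  next
    fix w assume "w \<in> ?B \<union> ?D"
    then show "w \<in> ?A"
    proof
      assume "w \<in> ?B"
      then have "w = f 0" "NU1_initial (obj 0)" using f0 NU1_initial_mvec_start by simp_all
      then show ?thesis by blast
    next
      assume "w \<in> ?D"
      then obtain t where t: "w = f (pos (Suc t))" "descending (M t)" unfolding f_pos by blast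
      moreover have "pos (Suc t) > 0" using pos_less_Suc[of t] by simp
      ultimately show ?thesis using initial_iff by blast
    qed
  }
qed

lemma part_d:
  "{S_vec (mvec start) j | j. j \<le> S_num (mvec start) \<and> NU1_initial (dclass (S_vec (mvec start) j))}
        = {w. w = mvec start \<and> (C = [] \<or> last C = 1)}
          \<union> {v_vec r n C i | i. 0 < i \<and> i \<le> r + 1 \<and> odd (n (i - 1))}
          \<union> {mid_vec r n C i c | i c. i \<le> r \<and> 0 < 2 * c \<and> 2 * c \<le> n i}
      \<and> {reduced \<delta> | \<delta>. \<delta> \<in> NU_chain (dclass (mvec start)) \<and> NU1_initial \<delta>}
        = {S_vec (mvec start) j | j. j \<le> S_num (mvec start) \<and> NU1_initial (dclass (S_vec (mvec start) j))}
      \<and> v_vec r n C (r+1) = S_vec (mvec start) (S_num (mvec start))"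
proof (intro conjI)
  show "v_vec r n C (r+1) = S_vec (mvec start) (S_num (mvec start))"
    using f_ix[of "Suc r"] by (simp add: S_vec_eq S_pos_last)
  have "{reduced \<delta> | \<delta>. \<delta> \<in> NU_chain (dclass (mvec start)) \<and> NU1_initial \<delta>}
      = {reduced (obj i) | i. NU1_initial (obj i)}"
    unfolding NU_chain_eq by blast
  then show "{reduced \<delta> | \<delta>. \<delta> \<in> NU_chain (dclass (mvec start)) \<and> NU1_initial \<delta>}
        = {S_vec (mvec start) j | j. j \<le> S_num (mvec start) \<and> NU1_initial (dclass (S_vec (mvec start) j))}"
    unfolding S_vec_initial_eq reduced_obj .
qed (unfold S_vec_initial_eq initial_vectors descending_vectors Un_assoc, rule refl)

lemma form_mvec_mstep:
  assumes "descending (M t)"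
  shows "form_00X1 (mvec (M (Suc t)))"
proof -
  obtain X where X: "mvec (mstep (M t)) = [0,0] @ X @ [1]"
    using mvec_mstep_last[of "M t"] assms by auto
  moreover have "set (mvec (mstep (M t))) \<subseteq> {0,1,2}" using set_mvec binary_M[of "Suc t"] by simp
  ultimately have "set X \<subseteq> {0,1,2}" by auto
  then show ?thesis using X by (auto simp: form_00X1_def)
qed

text \<open>The leading \<open>00\<close> places \<open>i\<close> at some
  \<open>pos (Suc t)\<close>, and the final 1 shows by \<open>mvec_mstep_last\<close> that the
  segment before it descended.\<close>

lemma initial_of_form:
  assumes "i > 0" "form_00X1 (f i)"
  shows "i \<in> initial_pos (mvec start)"
proof -
  from assms(2) obtain X where X: "f i = [0,0] @ X @ [1]" by (auto simp: form_00X1_def)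
  then obtain t' where "i = pos t'" using prefix_imp_pos by (metis prefixI)
  then obtain t where t: "i = pos (Suc t)" using assms(1) by (cases t') auto
  obtain Y where "mvec (M (Suc t)) = [0,0] @ Y @ [if descending (M t) then 1 else 0]"
    using mvec_mstep_last[of "M t"] by auto
  then have "descending (M t)" using X f_pos[of "Suc t"] t by (auto split: if_splits)
  then show ?thesis using t by (auto simp: initial_pos_eq)
qed

lemma part_e:
  "(\<forall>j<S_num (mvec start). 2 \<in> set (S_vec (mvec start) j))
      \<and> 2 \<notin> set (S_vec (mvec start) (S_num (mvec start)))
      \<and> (\<forall>j. 0 < j \<and> j \<le> S_num (mvec start) \<longrightarrow>
            dyck (S_vec (mvec start) j)
            \<and> reduced (dclass (S_vec (mvec start) j)) = S_vec (mvec start) j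
            \<and> form_00X1 (S_vec (mvec start) j))
      \<and> (\<forall>i. 0 < i \<and> i \<le> S_pos (mvec start) (S_num (mvec start)) \<and> form_00X1 (reduced (obj i)) \<longrightarrow>
            (\<exists>j. 0 < j \<and> j \<le> S_num (mvec start) \<and> reduced (obj i) = S_vec (mvec start) j))
      \<and> (\<forall>\<delta>\<in>NU_chain (dclass (mvec start)).
            min_delta \<delta> < min_delta (NU \<delta>) \<longleftrightarrow> prefix [0,0] (reduced \<delta>))"
proof (intro conjI allI impI ballI)
  fix j assume j: "j < S_num (mvec start)"
  obtain s e where s: "S_pos (mvec start) j = pos s" "descending (M (s + e))"
    using S_consecutive[OF j] by metis
  show "2 \<in> set (S_vec (mvec start) j)"
  \<comment> \<open>Without a 2 all multiplicities are 0 from there on, whereas reaching the next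
    S-vector takes a descent.\<close>
  proof (rule ccontr)
    assume "2 \<notin> set (S_vec (mvec start) j)"
    then have "2 \<notin> set (mvec (M s))" by (simp add: S_vec_eq s(1) f_pos)
    then have "\<forall>k\<in>set (fst (M s)). k = 0" using two_in_mvec_iff[OF binary_M[of s]] by simp
    then show False using zero_stays[of s "s + e"] not_descending_of_zero s(2) by simp
  qed
next
  have "2 \<notin> set (mvec (M idx_last))" using two_in_mvec_iff[OF binary_M] M_idx_last(2) by simp
  then show "2 \<notin> set (S_vec (mvec start) (S_num (mvec start)))"
    by (simp add: S_vec_eq S_pos_last f_pos ix_def)
next
  fix j assume j: "0 < j \<and> j \<le> S_num (mvec start)"
  show "dyck (S_vec (mvec start) j)" using red_f by (simp add: S_vec_eq red_def)
  show "reduced (dclass (S_vec (mvec start) j)) = S_vec (mvec start) j"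
    using red_min_delta(2)[OF red_f] by (simp add: S_vec_eq)
  obtain t where "S_pos (mvec start) j = pos (Suc t)" "descending (M t)"
    using S_pos_in j by (auto simp: initial_pos_eq)
  then show "form_00X1 (S_vec (mvec start) j)"
    using form_mvec_mstep[of t] f_pos[of "Suc t"] by (simp add: S_vec_eq)
next
  fix i assume i: "0 < i \<and> i \<le> S_pos (mvec start) (S_num (mvec start)) \<and> form_00X1 (reduced (obj i))"
  then have "i \<in> initial_pos (mvec start)" using initial_of_form by (simp add: reduced_obj)
  then obtain j where "0 < j" "j \<le> S_num (mvec start)" "S_pos (mvec start) j = i" by (rule S_pos_surj)
  then show "\<exists>j. 0 < j \<and> j \<le> S_num (mvec start) \<and> reduced (obj i) = S_vec (mvec start) j"
    unfolding reduced_obj S_vec_eq by blast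
next
  fix \<delta> assume "\<delta> \<in> NU_chain (dclass (mvec start))"
  then obtain i where i: "\<delta> = obj i" unfolding NU_chain_eq by blast
  then have "NU \<delta> = obj (Suc i)" by simp
  then show "min_delta \<delta> < min_delta (NU \<delta>) \<longleftrightarrow> prefix [0,0] (reduced \<delta>)"
    unfolding i by (simp only: min_delta_obj reduced_obj prefix_iff_length)
qed

lemma part_f:
  "(\<forall>j\<le>S_num (mvec start). length (S_vec (mvec start) j) = min_delta (dclass (S_vec (mvec start) j)))
      \<and> (\<forall>j<S_num (mvec start). stair_prefix (length (S_vec (mvec start) j))
            (profile (dclass (mvec start)) (S_pos (mvec start) j) (S_pos (mvec start) (j+1))))
      \<and> (\<forall>j. 0 < j \<and> j \<le> S_num (mvec start) \<longrightarrow>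
            min_delta (obj (S_pos (mvec start) j - 1)) = length (S_vec (mvec start) j) + 1)
      \<and> (\<forall>j\<le>S_num (mvec start).
            min_delta (obj (S_pos (mvec start) j + 1)) = length (S_vec (mvec start) j) + 1)
      \<and> (\<forall>j<S_num (mvec start). length (S_vec (mvec start) j) \<le> length (S_vec (mvec start) (j+1)))"
proof (intro conjI allI impI)
  fix j assume "j \<le> S_num (mvec start)"
  then obtain s where s: "S_pos (mvec start) j = pos s" by (rule S_pos_pos)
  show "length (S_vec (mvec start) j) = min_delta (dclass (S_vec (mvec start) j))"
    using red_min_delta(1)[OF red_f] by (simp add: S_vec_eq)
  show "min_delta (obj (S_pos (mvec start) j + 1)) = length (S_vec (mvec start) j) + 1"
    using length_f_Suc_pos[of s] length_f_pos[of s]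
    by (simp only: min_delta_obj S_vec_eq s Suc_eq_plus1)
next
  fix j assume "0 < j \<and> j \<le> S_num (mvec start)"
  then obtain t where t: "S_pos (mvec start) j = pos (Suc t)" "descending (M t)"
    using S_pos_in by (auto simp: initial_pos_eq)
  show "min_delta (obj (S_pos (mvec start) j - 1)) = length (S_vec (mvec start) j) + 1"
    using length_f_before_pos[of t] length_f_pos[of "Suc t"] L_Suc[of t] t(2)
    by (simp only: min_delta_obj S_vec_eq t(1) Suc_eq_plus1 if_True)
next
  fix j assume "j < S_num (mvec start)"
  then obtain s e where s: "S_pos (mvec start) j = pos s"
    "S_pos (mvec start) (Suc j) = pos (Suc (s + e))" and d: "descending (M (s + e))"
    and "\<forall>u. s \<le> u \<and> u < s + e \<longrightarrow> \<not> descending (M u)"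
    by (rule S_consecutive)
  then have nd: "\<not> descending (M u)" if "s \<le> u" "u < s + e" for u using that by blast
  note P = profile_flat[OF nd]
  have len: "length (S_vec (mvec start) j) = L s" "length (S_vec (mvec start) (Suc j)) = L s + e"
    using s length_f_pos P d by (simp_all add: S_vec_eq L_Suc)
  show "length (S_vec (mvec start) j) \<le> length (S_vec (mvec start) (j + 1))" by (simp add: len)
  let ?P = "profile (dclass (mvec start))" and ?p = "Suc (pos (s + e))"
  have "pos s \<le> pos (s + e)" using strict_mono_less_eq[OF strict_mono_pos] by simp
  then have "?P (pos s) (Suc ?p) = ?P (pos s) ?p @ ?P ?p (Suc ?p)" by (intro profile_split) simp_all
  moreover have "?P ?p (Suc ?p) = [L s + e + 1]"
    using length_f_Suc_pos[of "s + e"] P by (simp add: profile_eq)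
  \<comment> \<open>A descending segment has a single object strictly inside it.\<close>
  moreover have "pos (Suc (s + e)) = Suc ?p" using d by (simp add: pos.simps)
  ultimately have profile: "?P (pos s) (pos (Suc (s + e))) = stair_word (L s) e @ [L s + e + 1]"
    using P by simp
  \<comment> \<open>That object contributes the first letter of the next block of the stair
    word.\<close>
  have "replicate (L s + e) (L s + e + 1) = [L s + e + 1] @ replicate (L s + e - 1) (L s + e + 1)"
    using L_ge_2[of s] by (cases "L s + e") auto
  then have "stair_word (L s) (Suc e)
      = (stair_word (L s) e @ [L s + e + 1]) @ replicate (L s + e - 1) (L s + e + 1)"
    unfolding stair_word_Suc append_assoc by (rule arg_cong)
  then have "prefix (?P (pos s) (pos (Suc (s + e)))) (stair_word (L s) (Suc e))"
    unfolding profile by (rule prefixI)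
  then show "stair_prefix (length (S_vec (mvec start) j))
      (profile (dclass (mvec start)) (S_pos (mvec start) j) (S_pos (mvec start) (j + 1)))"
    using s len unfolding stair_prefix_def by auto
qed

text \<open>Only the descent between neighbouring S-vectors changes the area: it trades 22 for 11,
  or 12 for 01.\<close>

lemma part_g:
  "\<forall>j<S_num (mvec start). area (S_vec (mvec start) (j+1)) = area (S_vec (mvec start) j) - 2"
proof (intro allI impI)
  fix j assume "j < S_num (mvec start)"
  then obtain s e where s: "S_pos (mvec start) j = pos s"
    "S_pos (mvec start) (Suc j) = pos (Suc (s + e))" and d: "descending (M (s + e))"
    and "\<forall>u. s \<le> u \<and> u < s + e \<longrightarrow> \<not> descending (M u)"
    by (rule S_consecutive)
  then have nd: "\<not> descending (M u)" if "s \<le> u" "u < s + e" for u using that by blast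
  show "area (S_vec (mvec start) (j+1)) = area (S_vec (mvec start) j) - 2"
    using profile_flat[OF nd] d s by (simp add: S_vec_eq f_pos area_mvec_mstep)
qed

end

theorem theorem3p17:
  fixes r :: nat and n :: "nat \<Rightarrow> nat" and C v :: "int list"
  assumes n_last: "n r > 0"
    and C_binary: "set C \<subseteq> {0,1}"
    and v_eq: "v = [0,0] @ concat (map (\<lambda>k. 1 # replicate (n k) 2) [0..<Suc r]) @ C"
    and v_dyck: "dyck v"
  shows
    "\<comment> \<open>the chain is infinite and J is finite\<close>
     (\<forall>i. (NU ^^ i) (dclass v) \<in> NU_dom) \<and> finite (initial_pos v)
   \<and> \<comment> \<open>(a)\<close>
     (v_vec r n C 0 = v
      \<and> (\<forall>i\<le>r+1. dclass (v_vec r n C i) \<in> NU_chain (dclass v))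
      \<and> (\<exists>p. is_ptn p \<and> dclass (v_vec r n C (r+1)) = TI p))
   \<and> \<comment> \<open>(b)\<close>
     ((\<forall>i\<le>r+1. length (v_vec r n C i) = min_delta (dclass (v_vec r n C i)))
      \<and> (\<forall>i\<le>r. \<forall>a b. (NU ^^ a) (dclass v) = dclass (v_vec r n C i)
            \<and> (NU ^^ b) (dclass v) = dclass (v_vec r n C (i+1)) \<longrightarrow>
          (let L = length (v_vec r n C i) in
             profile (dclass v) a (Suc b)
               = L # concat (replicate ((n i + 1) div 2) [L + 1, L])
                 @ (if even (n i) \<and> i < r then replicate L (L + 1) else [])))
      \<and> (\<forall>m. stair_prefix (length (v_vec r n C (r+1)))
                (profile (dclass (v_vec r n C (r+1))) 0 m)))
   \<and> \<comment> \<open>(c)\<close>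
     (\<forall>i>0. NU1_initial ((NU ^^ i) (dclass v)) \<longleftrightarrow>
        min_delta ((NU ^^ (i - 1)) (dclass v)) > min_delta ((NU ^^ i) (dclass v)))
   \<and> \<comment> \<open>(d)\<close>
     ({S_vec v j | j. j \<le> S_num v \<and> NU1_initial (dclass (S_vec v j))}
        = {w. w = v \<and> (C = [] \<or> last C = 1)}
          \<union> {v_vec r n C i | i. 0 < i \<and> i \<le> r + 1 \<and> odd (n (i - 1))}
          \<union> {mid_vec r n C i c | i c. i \<le> r \<and> 0 < 2 * c \<and> 2 * c \<le> n i}
      \<and> {reduced \<delta> | \<delta>. \<delta> \<in> NU_chain (dclass v) \<and> NU1_initial \<delta>}
        = {S_vec v j | j. j \<le> S_num v \<and> NU1_initial (dclass (S_vec v j))}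
      \<and> v_vec r n C (r+1) = S_vec v (S_num v))
   \<and> \<comment> \<open>(e)\<close>
     ((\<forall>j<S_num v. 2 \<in> set (S_vec v j)) \<and> 2 \<notin> set (S_vec v (S_num v))
      \<and> (\<forall>j. 0 < j \<and> j \<le> S_num v \<longrightarrow>
            dyck (S_vec v j) \<and> reduced (dclass (S_vec v j)) = S_vec v j \<and> form_00X1 (S_vec v j))
      \<and> (\<forall>i. 0 < i \<and> i \<le> S_pos v (S_num v) \<and> form_00X1 (reduced ((NU ^^ i) (dclass v))) \<longrightarrow>
            (\<exists>j. 0 < j \<and> j \<le> S_num v \<and> reduced ((NU ^^ i) (dclass v)) = S_vec v j))
      \<and> (\<forall>\<delta>\<in>NU_chain (dclass v).
            min_delta \<delta> < min_delta (NU \<delta>) \<longleftrightarrow> prefix [0,0] (reduced \<delta>)))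
   \<and> \<comment> \<open>(f)\<close>
     ((\<forall>j\<le>S_num v. length (S_vec v j) = min_delta (dclass (S_vec v j)))
      \<and> (\<forall>j<S_num v. stair_prefix (length (S_vec v j))
            (profile (dclass v) (S_pos v j) (S_pos v (j+1))))
      \<and> (\<forall>j. 0 < j \<and> j \<le> S_num v \<longrightarrow>
            min_delta ((NU ^^ (S_pos v j - 1)) (dclass v)) = length (S_vec v j) + 1)
      \<and> (\<forall>j\<le>S_num v.
            min_delta ((NU ^^ (S_pos v j + 1)) (dclass v)) = length (S_vec v j) + 1)
      \<and> (\<forall>j<S_num v. length (S_vec v j) \<le> length (S_vec v (j+1))))
   \<and> \<comment> \<open>(g)\<close>
     (\<forall>j<S_num v. area (S_vec v (j+1)) = area (S_vec v j) - 2)"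
proof -
  interpret theorem_data r n C by unfold_locales (rule n_last C_binary)+
  have v: "v = mvec start" unfolding v_eq mvec_start ..
  show ?thesis
    unfolding v
    by (rule conjI[OF allI[OF NU_dom_obj] conjI[OF finite_initial_pos conjI[OF part_a
      conjI[OF part_b conjI[OF part_c conjI[OF part_d conjI[OF part_e conjI[OF part_f part_g]]]]]]]])
qed

end
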